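(* Let $C$ be a commutative ring, $n\ge1$, and let $A=C\{a_1,\dots,a_\ell\}$ be an affine PI-algebra over $C$ satisfying the Capelli identity $\mathrm{Cap}_{n+1}$. Then $\mathrm{Obst}_n(A)\cdot(\mathcal{CAP}_n(A))^2=0$.
   Context: $\mathrm{Cap}_m(x_1,\dots,x_m;y_1,\dots,y_m)=\sum_{\pi\in S_m}\operatorname{sgn}(\pi)x_{\pi(1)}y_1\cdots x_{\pi(m)}y_m$. $\mathcal{CAP}_n(A)$ is the ideal of $A$ generated by all evaluations of $\mathrm{Cap}_n$ on elements of $A$. For each $a\in A$ let $\xi_{1,a},\dots,\xi_{n,a}$ be new commuting (central) indeterminates, and let $A[\xi_{n,A}]=A[\xi_{1,a},\dots,\xi_{n,a}\mid a\in A]$ be the polynomial algebra over $A$ in all of these. Let $I_{n,A}$ be the ideal of $A[\xi_{n,A}]$ generated by the elements $a^n+\xi_{1,a}a^{n-1}+\cdots+\xi_{n,a}$, $a\in A$. Define $\mathrm{Obst}_n(A)=A\cap I_{n,A}$, viewing $A\subseteq A[\xi_{n,A}]$. *)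

theory Defs
  imports Main "HOL-Library.Poly_Mapping" "HOL-Combinatorics.Permutations"
begin

definition is_ideal :: "'a::ring_1 set \<Rightarrow> bool" where
  "is_ideal I \<longleftrightarrow> 0 \<in> I \<and> (\<forall>x\<in>I. \<forall>y\<in>I. x + y \<in> I) \<and> (\<forall>x\<in>I. - x \<in> I)
     \<and> (\<forall>x\<in>I. \<forall>r. r * x \<in> I \<and> x * r \<in> I)"

definition ideal_gen :: "'a::ring_1 set \<Rightarrow> 'a set" where
  "ideal_gen S = \<Inter>{I. is_ideal I \<and> S \<subseteq> I}"

definition ideal_mult :: "'a::ring_1 set \<Rightarrow> 'a set \<Rightarrow> 'a set" where
  "ideal_mult I J = {\<Sum>k<m. f k * g k | (m::nat) f g. \<forall>k<m. f k \<in> I \<and> g k \<in> J}"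

text \<open>C-subalgebra generated by S, where the C-algebra structure is given by a
  ring homomorphism phi from C into the centre of A.\<close>
inductive_set subalg_gen :: "('c \<Rightarrow> 'a::ring_1) \<Rightarrow> 'a set \<Rightarrow> 'a set"
  for phi :: "'c \<Rightarrow> 'a" and S :: "'a set" where
  base: "s \<in> S \<Longrightarrow> s \<in> subalg_gen phi S"
| scal: "phi c \<in> subalg_gen phi S"
| add: "x \<in> subalg_gen phi S \<Longrightarrow> y \<in> subalg_gen phi S \<Longrightarrow> x + y \<in> subalg_gen phi S"
| mult: "x \<in> subalg_gen phi S \<Longrightarrow> y \<in> subalg_gen phi S \<Longrightarrow> x * y \<in> subalg_gen phi S"

definition central_hom :: "('c::comm_ring_1 \<Rightarrow> 'a::ring_1) \<Rightarrow> bool" where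
  "central_hom phi \<longleftrightarrow> phi 0 = 0 \<and> phi 1 = 1 \<and> (\<forall>x y. phi (x + y) = phi x + phi y)
     \<and> (\<forall>x y. phi (x * y) = phi x * phi y) \<and> (\<forall>c a. phi c * a = a * phi c)"

definition Cap :: "nat \<Rightarrow> (nat \<Rightarrow> 'a::ring_1) \<Rightarrow> (nat \<Rightarrow> 'a) \<Rightarrow> 'a" where
  "Cap m x y = (\<Sum>\<pi> \<in> {\<pi>. \<pi> permutes {1..m}}.
       of_int (sign \<pi>) * prod_list (map (\<lambda>i. x (\<pi> i) * y i) [1..<m+1]))"

definition satisfies_Cap :: "nat \<Rightarrow> 'a::ring_1 itself \<Rightarrow> bool" where
  "satisfies_Cap m _ \<longleftrightarrow> (\<forall>x y :: nat \<Rightarrow> 'a. Cap m x y = 0)"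

definition CAP :: "nat \<Rightarrow> 'a::ring_1 set" where
  "CAP m = ideal_gen {Cap m x y | x y. True}"

text \<open>A[xi_{n,A}]: polynomials in commuting central indeterminates xi_{i,a}
  (indexed by pairs (i,a)) with coefficients in A. Monomials are finitely supported
  maps from pairs to nat; polynomials are finitely supported maps from monomials to A.
  Only the indeterminates with 1 \<le> i \<le> n belong to A[xi_{n,A}]; this is the subring PR n.\<close>
type_synonym 'a xpoly = "((nat \<times> 'a) \<Rightarrow>\<^sub>0 nat) \<Rightarrow>\<^sub>0 'a"

definition PR :: "nat \<Rightarrow> 'a::ring_1 xpoly set" where
  "PR n = {p :: 'a xpoly. \<forall>mo \<in> Poly_Mapping.keys p. \<forall>v \<in> Poly_Mapping.keys mo. 1 \<le> fst v \<and> fst v \<le> n}"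

definition const_poly :: "'a::ring_1 \<Rightarrow> 'a xpoly" where
  "const_poly a = Poly_Mapping.single 0 a"

definition xi :: "nat \<Rightarrow> 'a::ring_1 \<Rightarrow> 'a xpoly" where
  "xi i a = Poly_Mapping.single (Poly_Mapping.single (i, a) 1) 1"

definition char_gen :: "nat \<Rightarrow> 'a::ring_1 \<Rightarrow> 'a xpoly" where
  "char_gen n a = const_poly (a ^ n) + (\<Sum>i = 1..n. xi i a * const_poly (a ^ (n - i)))"

definition is_ideal_in :: "'b::ring_1 set \<Rightarrow> 'b set \<Rightarrow> bool" where
  "is_ideal_in R I \<longleftrightarrow> I \<subseteq> R \<and> 0 \<in> I \<and> (\<forall>x\<in>I. \<forall>y\<in>I. x + y \<in> I) \<and> (\<forall>x\<in>I. - x \<in> I)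
     \<and> (\<forall>x\<in>I. \<forall>r\<in>R. r * x \<in> I \<and> x * r \<in> I)"

definition ideal_gen_in :: "'b::ring_1 set \<Rightarrow> 'b set \<Rightarrow> 'b set" where
  "ideal_gen_in R S = \<Inter>{I. is_ideal_in R I \<and> S \<subseteq> I}"

definition I_ideal :: "nat \<Rightarrow> 'a::ring_1 xpoly set" where
  "I_ideal n = ideal_gen_in (PR n) (range (char_gen n))"

definition Obst :: "nat \<Rightarrow> 'a::ring_1 set" where
  "Obst n = {a. const_poly a \<in> I_ideal n}"

end

theory Submission
  imports Defs
begin

text \<open>
  For \<open>1 \<le> k \<le> n\<close> and \<open>b\<close> in the algebra let \<open>\<xi>\<^bsub>k,b\<^esub>\<close> act on a function \<open>f(x, t)\<close> of two blocks of
  \<open>n\<close> variables as \<open>(-1)\<^sup>k \<delta>\<^bsub>k,b\<^esub>\<close>, where \<open>\<delta>\<^bsub>k,b\<^esub> f\<close> is the sum, over the \<open>k\<close>-subsets \<open>S\<close> of the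
  first block, of \<open>f\<close> with \<open>b x\<^sub>i\<close> substituted for \<open>x\<^sub>i\<close>, \<open>i \<in> S\<close>. On the span of the functions
  \<open>y\<^sub>0 Cap\<^sub>n(x; y) y'\<^sub>0 Cap\<^sub>n(t; y')\<close> the identity \<open>Cap\<^bsub>n+1\<^esub>\<close> has two consequences.
  First, such a product does not change when the blocks \<open>x\<close> and \<open>t\<close> are exchanged, so the operators
  acting on \<open>x\<close> may be moved to \<open>t\<close>, and therefore they commute. Second,
  \<open>b\<^sup>n + \<xi>\<^bsub>1,b\<^esub> b\<^bsup>n-1\<^esup> + \<dots> + \<xi>\<^bsub>n,b\<^esub>\<close> acts as zero (Cayley--Hamilton). Hence the span is a
  module over \<open>A[\<xi>]/I\<close>, and an element of \<open>A \<inter> I\<close> multiplies all these products to zero.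
  Functions are used rather than their values because \<open>\<delta>\<^bsub>k,b\<^esub>\<close> need not be well defined on values.
\<close>

section \<open>Exchanging the variables of two Capelli products\<close>

text \<open>The Capelli polynomial over an arbitrary list of positions: it is used below on a second
  block \<open>[n+1..<2*n+1]\<close>, on the gapped list \<open>[1..<n+1] @ [r]\<close> and on
  \<open>[0..<n+1]\<close>.\<close>

definition altprod :: "nat list \<Rightarrow> (nat \<Rightarrow> 'a::ring_1) \<Rightarrow> (nat \<Rightarrow> 'a) \<Rightarrow> 'a" where
  "altprod L z y = (\<Sum>\<pi> | \<pi> permutes set L.
     of_int (sign \<pi>) * prod_list (map (\<lambda>i. z (\<pi> i) * y i) L))"

lemma atLeastAtMost_eq_set_upt: "{1..m} = set [1..<m+1]"
  by auto

lemma Cap_eq_altprod: "Cap m x y = altprod [1..<m+1] x y"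
  unfolding Cap_def altprod_def atLeastAtMost_eq_set_upt by simp

text \<open>Conjugation by the relabelling \<open>c\<close> is a sign-preserving bijection between
  the permutations of the two index sets, and it matches the summands one by one.\<close>

lemma altprod_map:
  assumes "inj_on c (set L)"
  shows "altprod (map c L) z y = altprod L (z \<circ> c) (y \<circ> c)"
proof -
  have bij: "bij_betw c (set L) (set (map c L))"
    using assms by (simp add: bij_betw_def)
  have "map_permutation (set L) c =
      (\<lambda>\<pi> x. if x \<in> set (map c L) then c (\<pi> (inv_into (set L) c x)) else x)"
    by (auto simp: fun_eq_iff map_permutation_def restrict_id_def)
  then have bij': "bij_betw (map_permutation (set L) c) {\<pi>. \<pi> permutes set L}
      {\<pi>. \<pi> permutes set (map c L)}"
    using bij_betw_permutations[OF bij] by simp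
  have "altprod L (z \<circ> c) (y \<circ> c) = (\<Sum>\<pi> | \<pi> permutes set L.
     of_int (sign (map_permutation (set L) c \<pi>)) *
     prod_list (map (\<lambda>i. z (map_permutation (set L) c \<pi> i) * y i) (map c L)))"
    unfolding altprod_def
  proof (rule sum.cong[OF refl])
    fix \<pi> assume "\<pi> \<in> {\<pi>. \<pi> permutes set L}"
    then have p: "\<pi> permutes set L" by simp
    have "sign (map_permutation (set L) c \<pi>) = sign \<pi>"
      using sign_map_permutation[OF assms p] by simp
    moreover have "map (\<lambda>i. (z \<circ> c) (\<pi> i) * (y \<circ> c) i) L =
        map (\<lambda>i. z (map_permutation (set L) c \<pi> i) * y i) (map c L)"
      using assms by (simp add: map_permutation_apply)
    ultimately show "of_int (sign \<pi>) * prod_list (map (\<lambda>i. (z \<circ> c) (\<pi> i) * (y \<circ> c) i) L) =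
      of_int (sign (map_permutation (set L) c \<pi>)) *
      prod_list (map (\<lambda>i. z (map_permutation (set L) c \<pi> i) * y i) (map c L))"
      by (simp only:)
  qed
  also have "\<dots> = altprod (map c L) z y"
    unfolding altprod_def
    by (rule sum.reindex_bij_betw[OF bij'])
  finally show ?thesis by simp
qed

lemma altprod_cong:
  assumes "\<And>i. i \<in> set L \<Longrightarrow> z i = z' i" "\<And>i. i \<in> set L \<Longrightarrow> y i = y' i"
  shows "altprod L z y = altprod L z' y'"
  unfolding altprod_def
  by (rule sum.cong[OF refl], rule arg_cong2[where f = times, OF refl], rule arg_cong[where f = prod_list])
     (use assms permutes_in_image in \<open>fastforce intro!: map_cong\<close>)

lemma altprod_eq_Cap:
  assumes "distinct L"
  shows "altprod L z y = Cap (length L) (\<lambda>i. z (L ! (i - 1))) (\<lambda>i. y (L ! (i - 1)))"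
proof -
  let ?c = "\<lambda>i. L ! (i - 1)"
  have "map ?c [1..<length L + 1] = L"
    by (rule nth_equalityI) (auto simp del: upt_Suc)
  moreover have "inj_on ?c (set [1..<length L + 1])"
    using assms by (auto simp: inj_on_def nth_eq_iff_index_eq)
  ultimately show ?thesis
    using altprod_map[of ?c "[1..<length L + 1]" z y] by (simp add: Cap_eq_altprod comp_def)
qed

lemma altprod_eq_0:
  fixes z y :: "nat \<Rightarrow> 'a::ring_1"
  assumes "satisfies_Cap m TYPE('a)" "distinct L" "length L = m"
  shows "altprod L z y = 0"
  using assms altprod_eq_Cap[of L z y] by (simp add: satisfies_Cap_def)

text \<open>Only the \<open>x\<close> are permuted, so \<open>y n\<close> ends every summand and can
  absorb whatever is multiplied on the right.\<close>

lemma Cap_insert_last: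
  assumes "n \<ge> 1"
  shows "Cap n x (y(n := y n * s)) = Cap n x y * s"
proof -
  have "prod_list (map (\<lambda>i. x (\<pi> i) * (y(n := y n * s)) i) [1..<n+1]) =
        prod_list (map (\<lambda>i. x (\<pi> i) * y i) [1..<n+1]) * s" for \<pi>
  proof -
    have upt: "[1..<n+1] = [1..<n] @ [n]" using assms by simp
    have "map (\<lambda>i. x (\<pi> i) * (y(n := y n * s)) i) [1..<n] = map (\<lambda>i. x (\<pi> i) * y i) [1..<n]"
      by auto
    then show ?thesis unfolding upt map_append by (simp only: prod_list.append) (simp add: mult.assoc)
  qed
  then show ?thesis
    unfolding Cap_def by (simp add: sum_distrib_right mult.assoc)
qed

text \<open>Closure makes \<open>G\<close> a disjoint union of orbits of right composition with
  permutations of \<open>X\<close>. Since \<open>\<sigma>\<close> is bijective, its orbit is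
  parametrised without repetition, and \<open>zero\<close> says that the sum over that orbit
  vanishes.\<close>

lemma sum_perm_orbits_eq_0:
  fixes f :: "(nat \<Rightarrow> nat) \<Rightarrow> 'a::ring_1"
  assumes "finite G" "finite X"
    and bij: "\<And>\<sigma>. \<sigma> \<in> G \<Longrightarrow> bij \<sigma>"
    and closed: "\<And>\<sigma> \<pi>. \<sigma> \<in> G \<Longrightarrow> \<pi> permutes X \<Longrightarrow> \<sigma> \<circ> \<pi> \<in> G"
    and zero: "\<And>\<sigma>. \<sigma> \<in> G \<Longrightarrow> (\<Sum>\<pi> | \<pi> permutes X. f (\<sigma> \<circ> \<pi>)) = 0"
  shows "sum f G = 0"
proof -
  define orb where "orb \<sigma> = (\<lambda>\<pi>. \<sigma> \<circ> \<pi>) ` {\<pi>. \<pi> permutes X}" for \<sigma> :: "nat \<Rightarrow> nat"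
  have mem: "\<sigma> \<in> orb \<sigma>" for \<sigma>
    unfolding orb_def by (rule image_eqI[of _ _ id]) (auto simp: permutes_id)
  have sub: "orb (\<sigma> \<circ> \<pi>) \<subseteq> orb \<sigma>" if "\<pi> permutes X" for \<sigma> \<pi>
    unfolding orb_def using that by (auto simp: comp_assoc intro!: image_eqI permutes_compose)
  have eq: "orb (\<sigma> \<circ> \<pi>) = orb \<sigma>" if p: "\<pi> permutes X" for \<sigma> \<pi>
  proof
    have "orb (\<sigma> \<circ> \<pi> \<circ> inv \<pi>) \<subseteq> orb (\<sigma> \<circ> \<pi>)"
      by (rule sub) (rule permutes_inv[OF p])
    then show "orb \<sigma> \<subseteq> orb (\<sigma> \<circ> \<pi>)"
      by (simp add: comp_assoc permutes_inv_o[OF p])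
  qed (rule sub[OF p])
  have "sum f G = sum (sum f) (orb ` G)"
  proof -
    have "\<Union> (orb ` G) = G"
      using mem closed by (auto simp: orb_def)
    moreover have "\<forall>A\<in>orb ` G. finite A"
      using assms(2) by (auto simp: orb_def finite_permutations)
    moreover have "\<forall>A\<in>orb ` G. \<forall>B\<in>orb ` G. A \<noteq> B \<longrightarrow> A \<inter> B = {}"
    proof (intro ballI impI)
      fix A B assume "A \<in> orb ` G" "B \<in> orb ` G" "A \<noteq> B"
      then obtain s t where st: "A = orb s" "B = orb t" by auto
      have "A = B" if "\<rho> \<in> A \<inter> B" for \<rho>
      proof -
        from that obtain p q where "p permutes X" "q permutes X" "\<rho> = s \<circ> p" "\<rho> = t \<circ> q"
          using st by (auto simp: orb_def)
        then show ?thesis using eq st by metis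
      qed
      with \<open>A \<noteq> B\<close> show "A \<inter> B = {}" by blast
    qed
    ultimately show ?thesis
      using sum.Union_disjoint[of "orb ` G" f] by simp
  qed
  also have "\<dots> = 0"
  proof (rule sum.neutral, rule ballI)
    fix A assume "A \<in> orb ` G"
    then obtain s where s: "s \<in> G" "A = orb s" by auto
    have "inj_on (\<lambda>\<pi>. s \<circ> \<pi>) {\<pi>. \<pi> permutes X}"
      using bij[OF s(1)] by (auto simp: inj_on_def bij_def fun_eq_iff inj_def)
    then show "sum f A = 0"
      using zero[OF s(1)] s(2) by (simp add: orb_def sum.reindex)
  qed
  finally show ?thesis .
qed

section \<open>Double alternating sums and the exchange of two blocks\<close>

definition block_swap :: "nat \<Rightarrow> nat \<Rightarrow> nat \<Rightarrow> nat" where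
  "block_swap n k i =
     (if i \<in> {1..k} then i + n else if i \<in> {n+1..n+k} then i - n else i)"

text \<open>The exchange of the whole blocks is the case \<open>k = n\<close>; the parameter lets
  the sign be counted by induction, one transposition per step.\<close>

lemma block_swap_permutes_sign:
  assumes "k \<le> n"
  shows "block_swap n k permutes {1..2*n} \<and> sign (block_swap n k) = (-1) ^ k"
  using assms
proof (induction k)
  case 0
  have "block_swap n 0 = id" by (auto simp: block_swap_def fun_eq_iff)
  then show ?case using permutes_id[of "{1..2*n}"] by (simp only: sign_id power_0 simp_thms)
next
  case (Suc k)
  have eq: "block_swap n (Suc k) = block_swap n k \<circ> transpose (Suc k) (n + Suc k)"
  proof
    fix i
    consider "i = Suc k" | "i = n + Suc k" | "i \<noteq> Suc k" "i \<noteq> n + Suc k" by blast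
    then show "block_swap n (Suc k) i = (block_swap n k \<circ> transpose (Suc k) (n + Suc k)) i"
      using Suc.prems by cases (auto simp: block_swap_def)
  qed
  have t: "transpose (Suc k) (n + Suc k) permutes {1..2*n}"
    using Suc.prems by (intro permutes_swap_id) auto
  have b: "block_swap n k permutes {1..2*n}" "sign (block_swap n k) = (-1) ^ k"
    using Suc by auto
  have "sign (block_swap n (Suc k)) = sign (block_swap n k) * sign (transpose (Suc k) (n + Suc k))"
    unfolding eq using b(1) t by (intro sign_compose) (auto intro: permutes_imp_permutation[rotated])
  also have "\<dots> = (-1) ^ Suc k"
    using Suc.prems by (simp add: b(2) sign_swap_id)
  finally show ?case
    using permutes_compose[OF t b(1)] unfolding eq by (simp only: simp_thms)
qed

text \<open>\<open>\<sigma> r\<close> is the index of the variable standing at position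
  \<open>r\<close>. Of the positions in the second block, exactly the first \<open>j\<close> hold
  variables of the first block: \<open>j = 0\<close> keeps the blocks apart, \<open>j = n\<close>
  exchanges them.\<close>

definition block_perms :: "nat \<Rightarrow> nat \<Rightarrow> (nat \<Rightarrow> nat) set" where
  "block_perms n j =
     {\<sigma>. \<sigma> permutes {1..2*n} \<and> (\<forall>r\<in>{n+1..2*n}. \<sigma> r \<le> n \<longleftrightarrow> r \<le> n + j)}"

definition alt_term :: "nat list \<Rightarrow> (nat \<Rightarrow> 'a::ring_1) \<Rightarrow> (nat \<Rightarrow> 'a) \<Rightarrow> (nat \<Rightarrow> nat) \<Rightarrow> 'a" where
  "alt_term L z y \<sigma> = of_int (sign \<sigma>) * prod_list (map (\<lambda>i. z (\<sigma> i) * y i) L)"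

lemma altprod_alt_term: "altprod L z y = sum (alt_term L z y) {\<pi>. \<pi> permutes set L}"
  by (simp add: altprod_def alt_term_def)

lemma upt_split: "i \<le> j \<Longrightarrow> j \<le> k \<Longrightarrow> [i..<k] = [i..<j] @ [j..<k]"
  using upt_add_eq_append[of i j "k - j"] by simp

text \<open>The union of the two sets is closed under permuting the \<open>n + 1\<close> positions
  \<open>1, \<dots>, n, n + j + 1\<close>, so the sum over it splits into values of \<open>Cap\<^bsub>n+1\<^esub>\<close>. Going from
  \<open>j = 0\<close> to \<open>j = n\<close> exchanges the two blocks without dividing by an integer.\<close>

lemma sum_block_perms_Suc:
  fixes z y :: "nat \<Rightarrow> 'a::ring_1"
  assumes cap: "satisfies_Cap (n + 1) TYPE('a)" and n: "n \<ge> 1" and j: "j < n"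
  shows "sum (alt_term [1..<2*n+1] z y) (block_perms n j) +
         sum (alt_term [1..<2*n+1] z y) (block_perms n (Suc j)) = 0"
proof -
  let ?f = "alt_term [1..<2*n+1] z y"
  define r where "r = n + j + 1"
  define X where "X = insert r {1..n}"
  \<comment> \<open>Position \<open>r\<close> is left free; whether
    \<open>\<sigma> r \<le> n\<close> decides to which of the two sets a member belongs.\<close>
  define B where "B = {\<sigma>. \<sigma> permutes {1..2*n} \<and> (\<forall>i\<in>{n+1..2*n} - {r}. \<sigma> i \<le> n \<longleftrightarrow> i \<le> n + j)}"
  have r: "n < r" "r \<le> 2*n" using j by (auto simp: r_def)
  have fin: "finite {\<sigma>. \<sigma> permutes {1..2*n}}" by (rule finite_permutations) simp
  have finG: "finite (block_perms n i)" for i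
    by (rule finite_subset[OF _ fin]) (auto simp: block_perms_def)
  have "B = block_perms n j \<union> block_perms n (Suc j)"
  proof (intro equalityI subsetI)
    fix \<sigma> assume s: "\<sigma> \<in> B"
    show "\<sigma> \<in> block_perms n j \<union> block_perms n (Suc j)"
    proof (cases "\<sigma> r \<le> n")
      case True
      have "\<sigma> i \<le> n \<longleftrightarrow> i \<le> n + Suc j" if "i \<in> {n+1..2*n}" for i
        using s True that by (cases "i = r") (auto simp: B_def r_def)
      then show ?thesis using s by (auto simp: B_def block_perms_def)
    next
      case False
      have "\<sigma> i \<le> n \<longleftrightarrow> i \<le> n + j" if "i \<in> {n+1..2*n}" for i
        using s False that by (cases "i = r") (auto simp: B_def r_def)
      then show ?thesis using s by (auto simp: B_def block_perms_def)
    qed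
  next
    fix \<sigma> assume "\<sigma> \<in> block_perms n j \<union> block_perms n (Suc j)"
    then obtain k where k: "k = j \<or> k = Suc j" "\<sigma> \<in> block_perms n k" by auto
    have "\<sigma> i \<le> n \<longleftrightarrow> i \<le> n + j" if "i \<in> {n+1..2*n} - {r}" for i
    proof -
      have "\<sigma> i \<le> n \<longleftrightarrow> i \<le> n + k" using k(2) that by (auto simp: block_perms_def)
      also have "\<dots> \<longleftrightarrow> i \<le> n + j" using k(1) that by (auto simp: r_def)
      finally show ?thesis .
    qed
    then show "\<sigma> \<in> B" using k(2) by (auto simp: B_def block_perms_def)
  qed
  moreover have "block_perms n j \<inter> block_perms n (Suc j) = {}"
  proof -
    have "r \<in> {n+1..2*n}" using r by auto
    then show ?thesis unfolding block_perms_def disjoint_iff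
    proof clarify
      fix x assume *: "\<forall>i\<in>{n+1..2*n}. (x i \<le> n) = (i \<le> n + j)"
        "\<forall>i\<in>{n+1..2*n}. (x i \<le> n) = (i \<le> n + Suc j)"
      have "r \<le> n + j \<longleftrightarrow> r \<le> n + Suc j"
        using *(1)[rule_format, of r] *(2)[rule_format, of r] r by simp
      then show False by (simp add: r_def)
    qed
  qed
  ultimately have "sum ?f (block_perms n j) + sum ?f (block_perms n (Suc j)) = sum ?f B"
    using finG by (simp add: sum.union_disjoint)
  also have "\<dots> = 0"
  proof (rule sum_perm_orbits_eq_0[where X = X])
    show "finite B" by (rule finite_subset[OF _ fin]) (auto simp: B_def)
    show "finite X" by (simp add: X_def)
    show "bij \<sigma>" if "\<sigma> \<in> B" for \<sigma> using that permutes_bij by (auto simp: B_def)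
    have XS: "X \<subseteq> {1..2*n}" using r by (auto simp: X_def)
    show "\<sigma> \<circ> \<pi> \<in> B" if "\<sigma> \<in> B" "\<pi> permutes X" for \<sigma> \<pi>
    proof -
      have "\<pi> i = i" if "i \<in> {n+1..2*n} - {r}" for i
        using \<open>\<pi> permutes X\<close> that by (intro permutes_not_in[of \<pi> X]) (auto simp: X_def)
      moreover have "\<sigma> \<circ> \<pi> permutes {1..2*n}"
        using that permutes_subset[OF that(2) XS] by (intro permutes_compose) (auto simp: B_def)
      ultimately show ?thesis using that(1) by (auto simp: B_def)
    qed
    fix \<sigma> assume s: "\<sigma> \<in> B"
    define M where "M A = prod_list (map (\<lambda>i. z (\<sigma> i) * y i) A)" for A
    define L where "L = [1..<n+1] @ [r]"
    \<comment> \<open>The positions strictly between \<open>n\<close> and \<open>r\<close> are fixed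
      by permutations of \<open>X\<close>. Their factors go into \<open>y n\<close>, which makes
      \<open>n\<close> and \<open>r\<close> adjacent, so that the orbit sum is, up to outer factors,
      an alternating product over \<open>L\<close>.\<close>
    define y' where "y' = y(n := y n * M [n+1..<r])"
    have setL: "set L = X" by (auto simp: L_def X_def)
    have upt: "[1..<2*n+1] = [1..<n] @ [n] @ [n+1..<r] @ [r] @ [r+1..<2*n+1]"
    proof -
      have "[1..<2*n+1] = [1..<r] @ [r..<2*n+1]"
        using r n by (intro upt_split) auto
      also have "[r..<2*n+1] = [r] @ [r+1..<2*n+1]"
        using r by (subst upt_conv_Cons) auto
      also have "[1..<r] = [1..<n] @ [n..<r]"
        using r n by (intro upt_split) auto
      also have "[n..<r] = [n] @ [n+1..<r]"
        using r by (subst upt_conv_Cons) auto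
      finally show ?thesis by simp
    qed
    have "?f (\<sigma> \<circ> \<pi>) = of_int (sign \<sigma>) * (alt_term L (z \<circ> \<sigma>) y' \<pi> * M [r+1..<2*n+1])"
      if p: "\<pi> permutes X" for \<pi>
    proof -
      have sg: "sign (\<sigma> \<circ> \<pi>) = sign \<sigma> * sign \<pi>"
        using s permutes_subset[OF p XS]
        by (intro sign_compose) (auto simp: B_def intro: permutes_imp_permutation[rotated])
      have fixed: "\<pi> i = i" if "n < i" "i \<noteq> r" for i
        using p that by (intro permutes_not_in[of \<pi> X]) (auto simp: X_def)
      have M1: "prod_list (map (\<lambda>i. z ((\<sigma> \<circ> \<pi>) i) * y i) [n+1..<r]) = M [n+1..<r]"
        unfolding M_def by (rule arg_cong[where f = prod_list]) (auto simp: fixed)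
      have M2: "prod_list (map (\<lambda>i. z ((\<sigma> \<circ> \<pi>) i) * y i) [r+1..<2*n+1]) = M [r+1..<2*n+1]"
        unfolding M_def using r by (intro arg_cong[where f = prod_list]) (auto simp: fixed)
      have L1: "prod_list (map (\<lambda>i. (z \<circ> \<sigma>) (\<pi> i) * y' i) [1..<n]) =
          prod_list (map (\<lambda>i. z ((\<sigma> \<circ> \<pi>) i) * y i) [1..<n])"
        by (rule arg_cong[where f = prod_list]) (auto simp: y'_def)
      have Lu: "L = [1..<n] @ [n] @ [r]" using n by (simp add: L_def)
      show ?thesis
        unfolding alt_term_def sg upt Lu map_append prod_list.append M1 M2 L1
        using r by (simp add: y'_def mult.assoc)
    qed
    then have "(\<Sum>\<pi> | \<pi> permutes X. ?f (\<sigma> \<circ> \<pi>)) =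
       of_int (sign \<sigma>) * (altprod L (z \<circ> \<sigma>) y' * M [r+1..<2*n+1])"
      by (simp add: altprod_alt_term setL sum_distrib_left sum_distrib_right)
    moreover have "altprod L (z \<circ> \<sigma>) y' = 0"
      using r by (intro altprod_eq_0[OF cap]) (auto simp: L_def)
    ultimately show "(\<Sum>\<pi> | \<pi> permutes X. ?f (\<sigma> \<circ> \<pi>)) = 0" by simp
  qed
  finally show ?thesis .
qed

text \<open>A permutation that maps the second block to itself is \<open>p \<circ> q\<close> for
  unique permutations of the two blocks, and its summand splits into a product accordingly.\<close>

lemma sum_block_perms_0:
  fixes z y :: "nat \<Rightarrow> 'a::ring_1"
  shows "sum (alt_term [1..<2*n+1] z y) (block_perms n 0) =
         altprod [1..<n+1] z y * altprod [n+1..<2*n+1] z y"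
proof -
  let ?B1 = "{1..n}" and ?B2 = "{n+1..2*n}"
  let ?P = "{\<pi>. \<pi> permutes ?B1}" and ?Q = "{\<pi>. \<pi> permutes ?B2}"
  have sets: "set [1..<n+1] = ?B1" "set [n+1..<2*n+1] = ?B2" by auto
  have upt: "[1..<2*n+1] = [1..<n+1] @ [n+1..<2*n+1]"
    by (rule upt_split) auto
  have split: "alt_term [1..<n+1] z y p * alt_term [n+1..<2*n+1] z y q =
      alt_term [1..<2*n+1] z y (p \<circ> q)" if "p \<in> ?P" "q \<in> ?Q" for p q
  proof -
    have pq: "p permutes ?B1" "q permutes ?B2" using that by auto
    have sg: "sign (p \<circ> q) = sign p * sign q"
      using pq by (intro sign_compose) (auto intro: permutes_imp_permutation[rotated])
    have 1: "map (\<lambda>i. z ((p \<circ> q) i) * y i) [1..<n+1] = map (\<lambda>i. z (p i) * y i) [1..<n+1]"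
      using permutes_not_in[OF pq(2)] by auto
    have "(p \<circ> q) i = q i" if "i \<in> ?B2" for i
      using permutes_not_in[OF pq(1)] permutes_in_image[OF pq(2), of i] that by auto
    then have 2: "map (\<lambda>i. z ((p \<circ> q) i) * y i) [n+1..<2*n+1] = map (\<lambda>i. z (q i) * y i) [n+1..<2*n+1]"
      by (auto simp del: comp_apply)
    have swap: "a * (of_int (sign q) * b) = of_int (sign q) * (a * b)" for a b :: 'a
      by (metis mult.assoc mult_of_int_commute)
    show ?thesis
      unfolding alt_term_def sg upt map_append prod_list.append 1 2
      by (simp only: of_int_mult mult.assoc swap)
  qed
  have inj: "inj_on (\<lambda>(p, q). p \<circ> q) (?P \<times> ?Q)"
  proof (rule inj_onI, clarify)
    fix p q p' q'
    assume p: "p permutes ?B1" "p' permutes ?B1" and q: "q permutes ?B2" "q' permutes ?B2"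
      and eq: "p \<circ> q = p' \<circ> q'"
    have "q i = q' i" for i
    proof (cases "i \<in> ?B2")
      case True
      then have "q i \<in> ?B2" "q' i \<in> ?B2" using permutes_in_image q by metis+
      then have "p (q i) = q i" "p' (q' i) = q' i"
        using permutes_not_in[OF p(1), of "q i"] permutes_not_in[OF p(2), of "q' i"] by auto
      then show ?thesis using fun_cong[OF eq, of i] by simp
    next
      case False
      then show ?thesis using permutes_not_in q by metis
    qed
    then have "q = q'" by auto
    moreover have "p = p'"
    proof -
      have "p = p \<circ> q \<circ> inv q" by (simp add: comp_assoc permutes_inv_o[OF q(1)])
      also have "\<dots> = p' \<circ> q' \<circ> inv q" by (simp only: eq)
      also have "\<dots> = p'" by (simp add: comp_assoc \<open>q = q'\<close> permutes_inv_o[OF q(2)])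
      finally show ?thesis .
    qed
    ultimately show "p = p' \<and> q = q'" by simp
  qed
  have img: "(\<lambda>(p, q). p \<circ> q) ` (?P \<times> ?Q) = block_perms n 0"
  proof (intro equalityI subsetI)
    fix \<sigma> assume "\<sigma> \<in> (\<lambda>(p, q). p \<circ> q) ` (?P \<times> ?Q)"
    then obtain p q where pq: "p permutes ?B1" "q permutes ?B2" "\<sigma> = p \<circ> q" by auto
    have "\<sigma> permutes {1..2*n}"
      unfolding pq(3) using pq(1,2) by (intro permutes_compose) (auto elim!: permutes_subset)
    moreover have "\<not> \<sigma> r \<le> n" if "r \<in> ?B2" for r
    proof -
      have "q r \<in> ?B2" using permutes_in_image pq(2) that by metis
      then show ?thesis using permutes_not_in[OF pq(1), of "q r"] by (auto simp: pq(3))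
    qed
    ultimately show "\<sigma> \<in> block_perms n 0" by (auto simp: block_perms_def)
  next
    fix \<sigma> assume s: "\<sigma> \<in> block_perms n 0"
    then have sp: "\<sigma> permutes {1..2*n}" by (simp add: block_perms_def)
    have s2: "\<sigma> r \<in> ?B2" if "r \<in> ?B2" for r
    proof -
      have "\<not> \<sigma> r \<le> n" using s that by (auto simp: block_perms_def)
      then show ?thesis using that permutes_in_image[OF sp, of r] by auto
    qed
    \<comment> \<open>\<open>q\<close> is \<open>\<sigma>\<close> on the second block and the
      identity elsewhere; \<open>\<sigma> \<circ> inv q\<close> then fixes the second block
      pointwise.\<close>
    define q where "q = restrict_id \<sigma> ?B2"
    have q: "q permutes ?B2"
    proof (rule bij_imp_permutes)
      have "inj_on \<sigma> ?B2" using permutes_inj[OF sp] by (rule inj_on_subset) simp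
      moreover have "\<sigma> ` ?B2 \<subseteq> ?B2" using s2 by blast
      ultimately have "bij_betw \<sigma> ?B2 ?B2"
        using endo_inj_surj[of ?B2 \<sigma>] by (auto simp: bij_betw_def)
      then show "bij_betw q ?B2 ?B2"
        unfolding q_def by (simp add: bij_betw_restrict_id)
      show "q x = x" if "x \<notin> ?B2" for x using that unfolding q_def restrict_id_def by (simp only: if_False)
    qed
    have "\<sigma> \<circ> inv q permutes ?B1"
    proof (rule permutes_superset)
      show "\<sigma> \<circ> inv q permutes {1..2*n}"
        using permutes_subset[OF permutes_inv[OF q], of "{1..2*n}"] sp
        by (intro permutes_compose) auto
      fix x assume "x \<in> {1..2*n} - ?B1"
      then have "x \<in> ?B2" by auto
      then have "inv q x \<in> ?B2" using permutes_in_image[OF permutes_inv[OF q]] by metis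
      then have "\<sigma> (inv q x) = q (inv q x)"
        unfolding q_def restrict_id_def by (simp only: if_True)
      then show "(\<sigma> \<circ> inv q) x = x" using permutes_inverses(1)[OF q] by simp
    qed
    moreover have "\<sigma> = (\<sigma> \<circ> inv q) \<circ> q" by (simp add: comp_assoc permutes_inv_o[OF q])
    ultimately show "\<sigma> \<in> (\<lambda>(p, q). p \<circ> q) ` (?P \<times> ?Q)"
      using q by (intro image_eqI[of _ _ "(\<sigma> \<circ> inv q, q)"]) auto
  qed
  have "altprod [1..<n+1] z y * altprod [n+1..<2*n+1] z y =
      (\<Sum>(p, q)\<in>?P \<times> ?Q. alt_term [1..<n+1] z y p * alt_term [n+1..<2*n+1] z y q)"
    unfolding altprod_alt_term sets by (simp only: sum_product sum.cartesian_product)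
  also have "\<dots> = (\<Sum>x\<in>?P \<times> ?Q. alt_term [1..<2*n+1] z y ((\<lambda>(p, q). p \<circ> q) x))"
    using split by (intro sum.cong) auto
  also have "\<dots> = sum (alt_term [1..<2*n+1] z y) (block_perms n 0)"
    unfolding img[symmetric] by (simp only: sum.reindex[OF inj] comp_def)
  finally show ?thesis by simp
qed

lemma minus_one_power_cancel: "(-1) ^ n * ((-1) ^ n * a) = (a :: 'a::ring_1)"
  by (cases "even n") auto

text \<open>Passing from \<open>block_perms n 0\<close> to \<open>block_perms n n\<close> costs
  \<open>n\<close> changes of sign. Composition with \<open>\<tau>\<close> leads back to
  \<open>block_perms n 0\<close> and costs \<open>sign \<tau> = (-1) ^ n\<close>, so the signs
  cancel.\<close>

lemma altprod_swap:
  fixes z y :: "nat \<Rightarrow> 'a::ring_1"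
  assumes cap: "satisfies_Cap (n + 1) TYPE('a)" and n: "n \<ge> 1"
  defines "\<tau> \<equiv> block_swap n n"
  shows "altprod [1..<n+1] z y * altprod [n+1..<2*n+1] z y =
         altprod [1..<n+1] (z \<circ> \<tau>) y * altprod [n+1..<2*n+1] (z \<circ> \<tau>) y"
proof -
  let ?f = "\<lambda>z. alt_term [1..<2*n+1] z y"
  have tau: "\<tau> permutes {1..2*n}" "sign \<tau> = (-1) ^ n"
    using block_swap_permutes_sign[of n n] by (auto simp: \<tau>_def)
  have tt: "\<tau> (\<tau> i) = i" for i by (auto simp: \<tau>_def block_swap_def)
  have step: "sum (?f z) (block_perms n 0) = (-1) ^ j * sum (?f z) (block_perms n j)" if "j \<le> n" for j
    using that
  proof (induction j)
    case (Suc j)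
    then have "sum (?f z) (block_perms n j) = - sum (?f z) (block_perms n (Suc j))"
      using sum_block_perms_Suc[OF cap n, of j z y] by (simp add: eq_neg_iff_add_eq_0)
    then show ?case using Suc by simp
  qed simp
  have "sum (?f z) (block_perms n n) = (\<Sum>\<sigma>\<in>block_perms n 0. ?f z (\<tau> \<circ> \<sigma>))"
  proof (rule sum.reindex_bij_witness[where i = "\<lambda>\<sigma>. \<tau> \<circ> \<sigma>" and j = "\<lambda>\<sigma>. \<tau> \<circ> \<sigma>"])
    fix \<sigma> assume s: "\<sigma> \<in> block_perms n n"
    show "\<tau> \<circ> (\<tau> \<circ> \<sigma>) = \<sigma>" by (auto simp: tt)
    then show "?f z (\<tau> \<circ> (\<tau> \<circ> \<sigma>)) = ?f z \<sigma>" by simp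
    have sp: "\<sigma> permutes {1..2*n}" using s by (simp add: block_perms_def)
    have "\<not> \<tau> (\<sigma> r) \<le> n" if "r \<in> {n+1..2*n}" for r
    proof -
      have "\<sigma> r \<le> n" using s that by (auto simp: block_perms_def)
      then show ?thesis
        using that permutes_in_image[OF sp, of r] by (auto simp: \<tau>_def block_swap_def)
    qed
    then show "\<tau> \<circ> \<sigma> \<in> block_perms n 0"
      using permutes_compose[OF sp tau(1)] by (auto simp: block_perms_def)
  next
    fix \<sigma> assume s: "\<sigma> \<in> block_perms n 0"
    show "\<tau> \<circ> (\<tau> \<circ> \<sigma>) = \<sigma>" by (auto simp: tt)
    have sp: "\<sigma> permutes {1..2*n}" using s by (simp add: block_perms_def)
    have "\<tau> (\<sigma> r) \<le> n" if "r \<in> {n+1..2*n}" for r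
    proof -
      have "\<not> \<sigma> r \<le> n" using s that by (auto simp: block_perms_def)
      then show ?thesis
        using that permutes_in_image[OF sp, of r] by (auto simp: \<tau>_def block_swap_def)
    qed
    then show "\<tau> \<circ> \<sigma> \<in> block_perms n n"
      using permutes_compose[OF sp tau(1)] by (auto simp: block_perms_def)
  qed
  also have "\<dots> = (\<Sum>\<sigma>\<in>block_perms n 0. (-1) ^ n * ?f (z \<circ> \<tau>) \<sigma>)"
  proof (rule sum.cong[OF refl])
    fix \<sigma> assume "\<sigma> \<in> block_perms n 0"
    then have "sign (\<tau> \<circ> \<sigma>) = sign \<tau> * sign \<sigma>"
      using tau by (intro sign_compose) (auto simp: block_perms_def intro: permutes_imp_permutation[rotated])
    then show "?f z (\<tau> \<circ> \<sigma>) = (-1) ^ n * ?f (z \<circ> \<tau>) \<sigma>"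
      by (simp add: alt_term_def tau(2) mult.assoc)
  qed
  finally have "sum (?f z) (block_perms n 0) = sum (?f (z \<circ> \<tau>)) (block_perms n 0)"
    using step[of n] by (simp add: sum_distrib_left[symmetric] minus_one_power_cancel)
  then show ?thesis by (simp only: sum_block_perms_0)
qed

text \<open>The coefficient \<open>y 0\<close> in front makes room for left multiplication and for a
  factor \<open>b\<close> before the first variable.\<close>

definition Capl :: "nat \<Rightarrow> (nat \<Rightarrow> 'a::ring_1) \<Rightarrow> (nat \<Rightarrow> 'a) \<Rightarrow> 'a" where
  "Capl n x y = y 0 * Cap n x y"

lemma Capl_swap:
  fixes x t y y' :: "nat \<Rightarrow> 'a::ring_1"
  assumes cap: "satisfies_Cap (n + 1) TYPE('a)" and n: "n \<ge> 1"
  shows "Capl n x y * Capl n t y' = Capl n t y * Capl n x y'"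
proof -
  define join where "join a b = (\<lambda>i. if i \<le> n then a i else b (i - n))" for a b :: "nat \<Rightarrow> 'a"
  \<comment> \<open>Both alternating products use coefficients from index 1 of their block on. So
    \<open>y' 0\<close> is attached to the end of the first block, while \<open>y 0\<close> stays
    outside as a left factor.\<close>
  let ?y = "join (y(n := y n * y' 0)) y'"
  have L2: "[n+1..<2*n+1] = map (\<lambda>i. i + n) [1..<n+1]"
    by (rule nth_equalityI) (auto simp del: upt_Suc)
  have 1: "altprod [1..<n+1] (join a b) ?y = Cap n a y * y' 0" for a b
    unfolding Cap_insert_last[OF n, symmetric] unfolding Cap_eq_altprod
    by (rule altprod_cong) (auto simp: join_def)
  have 2: "altprod [n+1..<2*n+1] (join a b) ?y = Cap n b y'" for a b
    unfolding L2 Cap_eq_altprod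
    by (subst altprod_map, simp, rule altprod_cong) (auto simp: join_def)
  have 3: "altprod [1..<n+1] (join x t \<circ> block_swap n n) ?y = altprod [1..<n+1] (join t x) ?y"
    by (rule altprod_cong) (auto simp: join_def block_swap_def)
  have 4: "altprod [n+1..<2*n+1] (join x t \<circ> block_swap n n) ?y = altprod [n+1..<2*n+1] (join t x) ?y"
    by (rule altprod_cong) (auto simp: join_def block_swap_def)
  show ?thesis
    using altprod_swap[OF cap n, of "join x t" ?y]
    unfolding 1 2 3 4 Capl_def by (simp only: mult.assoc)
qed

section \<open>The operators \<open>\<delta>\<close>\<close>

definition scale_on :: "'a::ring_1 \<Rightarrow> nat set \<Rightarrow> (nat \<Rightarrow> 'a) \<Rightarrow> nat \<Rightarrow> 'a" where
  "scale_on b S x = (\<lambda>i. if i \<in> S then b * x i else x i)"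

definition ksubsets :: "nat \<Rightarrow> nat \<Rightarrow> nat set set" where
  "ksubsets n k = {S. S \<subseteq> {1..n} \<and> card S = k}"

lemma finite_ksubsets [simp]: "finite (ksubsets n k)"
  unfolding ksubsets_def by (rule finite_subset[of _ "Pow {1..n}"]) auto

lemma finite_of_ksubsets: "S \<in> ksubsets n k \<Longrightarrow> finite S"
  by (auto simp: ksubsets_def intro: finite_subset)

lemma ksubsets_0: "ksubsets n 0 = {{}}"
proof -
  have "S = {}" if "S \<in> ksubsets n 0" for S
    using finite_of_ksubsets[OF that] that by (simp add: ksubsets_def)
  moreover have "{} \<in> ksubsets n 0" by (simp add: ksubsets_def)
  ultimately show ?thesis by blast
qed

text \<open>A factor \<open>b\<close> in front of position \<open>Suc i\<close> is read as the end
  of the coefficient \<open>y i\<close>. Thus \<open>P\<close> consists of positions, whereas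
  \<open>scale_on\<close> takes indices of variables.\<close>

definition scale_gaps :: "'a::ring_1 \<Rightarrow> nat set \<Rightarrow> (nat \<Rightarrow> 'a) \<Rightarrow> nat \<Rightarrow> 'a" where
  "scale_gaps b P y = (\<lambda>i. if Suc i \<in> P then y i * b else y i)"

lemma Capl_sum:
  "Capl n x y = (\<Sum>\<pi> | \<pi> permutes {1..n}.
     of_int (sign \<pi>) * (y 0 * prod_list (map (\<lambda>i. x (\<pi> i) * y i) [1..<n+1])))"
  unfolding Capl_def Cap_def sum_distrib_left
  by (rule sum.cong[OF refl]) (metis mult.assoc mult_of_int_commute)

text \<open>This is reassociation. The intersection with \<open>{1..n}\<close> keeps
  \<open>b\<close> out of the last coefficient \<open>y n\<close>, which no variable follows; in the
  induction step only that coefficient changes.\<close>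

lemma scale_gaps_prod:
  "y 0 * prod_list (map (\<lambda>i. (if i \<in> P then b * z i else z i) * y i) [1..<n+1]) =
   scale_gaps b (P \<inter> {1..n}) y 0 * prod_list (map (\<lambda>i. z i * scale_gaps b (P \<inter> {1..n}) y i) [1..<n+1])"
proof (induction n)
  case 0
  show ?case by (simp add: scale_gaps_def)
next
  case (Suc n)
  let ?g = "\<lambda>n. scale_gaps b (P \<inter> {1..n}) y"
  let ?c = "if Suc n \<in> P then b else 1"
  have "?g (Suc n) 0 * prod_list (map (\<lambda>i. z i * ?g (Suc n) i) [1..<n+1]) =
        ?g n 0 * prod_list (map (\<lambda>i. z i * ?g n i) [1..<n+1]) * ?c"
  proof (cases n)
    case 0
    then show ?thesis by (simp add: scale_gaps_def)
  next
    case (Suc m)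
    have upt: "[1..<n+1] = [1..<n] @ [n]" using Suc by simp
    have a: "map (\<lambda>i. z i * ?g (Suc n) i) [1..<n] = map (\<lambda>i. z i * ?g n i) [1..<n]"
      by (auto simp: scale_gaps_def)
    have b: "?g (Suc n) 0 = ?g n 0" "?g (Suc n) n = ?g n n * ?c"
      using Suc by (auto simp: scale_gaps_def)
    show ?thesis unfolding upt map_append prod_list.append a b(1)
      using b(2) by (simp add: mult.assoc)
  qed
  moreover have "?g (Suc n) (Suc n) = y (Suc n)" by (simp add: scale_gaps_def)
  moreover have "[1..<Suc n + 1] = [1..<n+1] @ [Suc n]" by simp
  ultimately have "?g (Suc n) 0 * prod_list (map (\<lambda>i. z i * ?g (Suc n) i) [1..<Suc n+1]) =
     ?g n 0 * prod_list (map (\<lambda>i. z i * ?g n i) [1..<n+1]) * (?c * (z (Suc n) * y (Suc n)))"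
    by (simp del: upt_Suc add: mult.assoc[symmetric])
  also have "\<dots> = y 0 * prod_list (map (\<lambda>i. (if i \<in> P then b * z i else z i) * y i) [1..<n+1])
      * (?c * (z (Suc n) * y (Suc n)))"
    by (simp only: Suc.IH)
  also have "\<dots> = y 0 * prod_list (map (\<lambda>i. (if i \<in> P then b * z i else z i) * y i) [1..<Suc n+1])"
    by (simp add: mult.assoc)
  finally show ?case by simp
qed

text \<open>A factor \<open>b\<close> in front of the variables indexed by \<open>S\<close> sits, in the summand of the
  permutation \<open>\<pi>\<close>, at the positions \<open>\<pi>\<^sup>-\<^sup>1 S\<close>.\<close>

lemma sum_Capl_scale_on:
  fixes x y :: "nat \<Rightarrow> 'a::ring_1"
  shows "(\<Sum>S\<in>ksubsets n k. Capl n (scale_on b S x) y) =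
    (\<Sum>P\<in>ksubsets n k. Capl n x (scale_gaps b P y))"
proof -
  let ?w = "\<lambda>\<pi> P. y 0 * prod_list (map (\<lambda>i. (if i \<in> P then b * x (\<pi> i) else x (\<pi> i)) * y i) [1..<n+1])"
  have 1: "y 0 * prod_list (map (\<lambda>i. scale_on b (\<pi> ` P) x (\<pi> i) * y i) [1..<n+1]) = ?w \<pi> P"
    if "\<pi> permutes {1..n}" for \<pi> P
    using inj_image_mem_iff[OF permutes_inj[OF that]] by (simp add: scale_on_def)
  have 2: "?w \<pi> P = scale_gaps b P y 0 * prod_list (map (\<lambda>i. x (\<pi> i) * scale_gaps b P y i) [1..<n+1])"
    if "P \<in> ksubsets n k" for P \<pi>
    using scale_gaps_prod[of y P b "\<lambda>i. x (\<pi> i)" n] that by (simp add: ksubsets_def Int_absorb2)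
  have 3: "(\<Sum>S\<in>ksubsets n k. g S) = (\<Sum>P\<in>ksubsets n k. g (\<pi> ` P))"
    \<comment> \<open>The passage from variables to positions depends on \<open>\<pi>\<close>; it is
      harmless because all \<open>k\<close>-subsets are summed over.\<close>
    if p: "\<pi> permutes {1..n}" for \<pi> and g :: "nat set \<Rightarrow> 'a"
  proof (rule sum.reindex_bij_witness[where i = "\<lambda>P. \<pi> ` P" and j = "\<lambda>P. inv \<pi> ` P"])
    have card: "card (\<rho> ` P) = card P" "\<rho> ` P \<subseteq> {1..n}" if "\<rho> permutes {1..n}" "P \<subseteq> {1..n}" for \<rho> P
      using card_image[OF inj_on_subset[OF permutes_inj[OF that(1)]], of P] image_mono[OF that(2), of \<rho>]
        permutes_image[OF that(1)] by auto
    show "\<pi> ` inv \<pi> ` S = S" "inv \<pi> ` \<pi> ` S = S" for S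
      by (simp_all add: image_comp permutes_inv_o[OF p])
    then show "g (\<pi> ` inv \<pi> ` S) = g S" for S by simp
    show "\<pi> ` S \<in> ksubsets n k" "inv \<pi> ` S \<in> ksubsets n k" if "S \<in> ksubsets n k" for S
      using that card[OF p, of S] card[OF permutes_inv[OF p], of S] by (auto simp: ksubsets_def)
  qed
  have "(\<Sum>S\<in>ksubsets n k. Capl n (scale_on b S x) y) =
    (\<Sum>\<pi> | \<pi> permutes {1..n}. \<Sum>S\<in>ksubsets n k. of_int (sign \<pi>) *
      (y 0 * prod_list (map (\<lambda>i. scale_on b S x (\<pi> i) * y i) [1..<n+1])))"
    unfolding Capl_sum by (rule sum.swap)
  also have "\<dots> = (\<Sum>\<pi> | \<pi> permutes {1..n}. \<Sum>P\<in>ksubsets n k. of_int (sign \<pi>) *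
      (scale_gaps b P y 0 * prod_list (map (\<lambda>i. x (\<pi> i) * scale_gaps b P y i) [1..<n+1])))"
  proof (rule sum.cong[OF refl])
    fix \<pi> assume "\<pi> \<in> {\<pi>. \<pi> permutes {1..n}}"
    then have p: "\<pi> permutes {1..n}" by simp
    show "(\<Sum>S\<in>ksubsets n k. of_int (sign \<pi>) *
      (y 0 * prod_list (map (\<lambda>i. scale_on b S x (\<pi> i) * y i) [1..<n+1]))) =
      (\<Sum>P\<in>ksubsets n k. of_int (sign \<pi>) *
      (scale_gaps b P y 0 * prod_list (map (\<lambda>i. x (\<pi> i) * scale_gaps b P y i) [1..<n+1])))"
      by (subst 3[OF p], rule sum.cong[OF refl]) (simp only: 1[OF p] 2)
  qed
  also have "\<dots> = (\<Sum>P\<in>ksubsets n k. Capl n x (scale_gaps b P y))"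
    unfolding Capl_sum by (rule sum.swap)
  finally show ?thesis .
qed

text \<open>Exchange \<open>x\<close> and \<open>t\<close>, write the operator as a change of the
  coefficients \<open>y'\<close>, exchange back, and read the changed coefficients as an operator on
  \<open>t\<close>.\<close>

lemma Capl_transfer:
  fixes x t y y' :: "nat \<Rightarrow> 'a::ring_1"
  assumes "satisfies_Cap (n + 1) TYPE('a)" "n \<ge> 1"
  shows "(\<Sum>S\<in>ksubsets n k. Capl n (scale_on b S x) y * Capl n t y') =
         (\<Sum>S\<in>ksubsets n k. Capl n x y * Capl n (scale_on b S t) y')"
proof -
  note sw = Capl_swap[OF assms]
  have "(\<Sum>S\<in>ksubsets n k. Capl n (scale_on b S x) y * Capl n t y') =
      Capl n t y * (\<Sum>S\<in>ksubsets n k. Capl n (scale_on b S x) y')"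
    by (simp add: sw[of _ y t y'] sum_distrib_left)
  also have "\<dots> = (\<Sum>P\<in>ksubsets n k. Capl n t y * Capl n x (scale_gaps b P y'))"
    by (simp only: sum_Capl_scale_on sum_distrib_left)
  also have "\<dots> = Capl n x y * (\<Sum>P\<in>ksubsets n k. Capl n t (scale_gaps b P y'))"
    by (simp add: sw[of t y x] sum_distrib_left)
  finally show ?thesis
    by (simp only: sum_Capl_scale_on[symmetric] sum_distrib_left)
qed

text \<open>For \<open>f\<close> multilinear in the first block this is the coefficient of
  \<open>\<lambda>^k\<close> in \<open>f (x + \<lambda> b x) t\<close>. The model is an alternating
  \<open>n\<close>-linear form on a free module of rank \<open>n\<close> over a commutative ring,
  which gets multiplied by the trace of the \<open>k\<close>-th exterior power of
  \<open>b\<close>.\<close>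

definition delta :: "nat \<Rightarrow> nat \<Rightarrow> 'a::ring_1 \<Rightarrow> ((nat \<Rightarrow> 'a) \<Rightarrow> (nat \<Rightarrow> 'a) \<Rightarrow> 'a) \<Rightarrow> (nat \<Rightarrow> 'a) \<Rightarrow> (nat \<Rightarrow> 'a) \<Rightarrow> 'a"
  where "delta n k b f = (\<lambda>x t. \<Sum>S\<in>ksubsets n k. f (scale_on b S x) t)"

text \<open>Closure under left multiplication, and in particular under negation, comes from the
  freedom in \<open>y 0\<close>.\<close>

inductive_set Capl2_span :: "nat \<Rightarrow> ((nat \<Rightarrow> 'a::ring_1) \<Rightarrow> (nat \<Rightarrow> 'a) \<Rightarrow> 'a) set" for n where
  zero: "(\<lambda>x t. 0) \<in> Capl2_span n"
| gen: "(\<lambda>x t. Capl n x y * Capl n t y') \<in> Capl2_span n"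
| add: "f \<in> Capl2_span n \<Longrightarrow> g \<in> Capl2_span n \<Longrightarrow> (\<lambda>x t. f x t + g x t) \<in> Capl2_span n"

lemma Capl2_span_sum:
  "finite I \<Longrightarrow> (\<And>i. i \<in> I \<Longrightarrow> f i \<in> Capl2_span n) \<Longrightarrow> (\<lambda>x t. \<Sum>i\<in>I. f i x t) \<in> Capl2_span n"
  by (induction I rule: finite_induct) (auto intro: Capl2_span.intros)

lemma Capl2_span_mult_left:
  "f \<in> Capl2_span n \<Longrightarrow> (\<lambda>x t. a * f x t) \<in> Capl2_span n"
proof (induction rule: Capl2_span.induct)
  case (gen y y')
  have "(\<lambda>x t. a * (Capl n x y * Capl n t y')) = (\<lambda>x t. Capl n x (y(0 := a * y 0)) * Capl n t y')"
    unfolding Capl_def Cap_def by (auto simp: mult.assoc fun_eq_iff intro!: arg_cong2[where f = times] sum.cong arg_cong[where f = prod_list])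
  then show ?case using Capl2_span.gen[of n "y(0 := a * y 0)" y'] by simp
qed (auto simp: distrib_left intro: Capl2_span.intros)

lemma delta_add: "delta n k b (\<lambda>x t. f x t + g x t) = (\<lambda>x t. delta n k b f x t + delta n k b g x t)"
  by (simp add: delta_def sum.distrib)

lemma delta_zero: "delta n k b (\<lambda>x t. 0) = (\<lambda>x t. 0)"
  by (simp add: delta_def)

lemma delta_mult_left: "delta n k b (\<lambda>x t. a * f x t) = (\<lambda>x t. a * delta n k b f x t)"
  by (simp add: delta_def sum_distrib_left)

lemma delta_gen:
  "delta n k b (\<lambda>x t. Capl n x y * Capl n t y') =
   (\<lambda>x t. \<Sum>P\<in>ksubsets n k. Capl n x (scale_gaps b P y) * Capl n t y')"
  by (simp add: delta_def sum_distrib_right[symmetric] sum_Capl_scale_on)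

lemma delta_in_Capl2_span: "f \<in> Capl2_span n \<Longrightarrow> delta n k b f \<in> Capl2_span n"
proof (induction rule: Capl2_span.induct)
  case (gen y y')
  show ?case unfolding delta_gen by (intro Capl2_span_sum) (auto intro: Capl2_span.intros)
qed (auto simp: delta_add delta_zero intro: Capl2_span.intros)

text \<open>Once one operator is moved to the block \<open>t\<close>, the two act on different
  blocks. Both composites are brought to \<open>?g\<close>, where \<open>c\<close> acts on
  \<open>x\<close> and \<open>b\<close> on \<open>t\<close>.\<close>

lemma delta_commute:
  fixes f :: "(nat \<Rightarrow> 'a::ring_1) \<Rightarrow> (nat \<Rightarrow> 'a) \<Rightarrow> 'a"
  assumes cap: "satisfies_Cap (n + 1) TYPE('a)" "n \<ge> 1" and "f \<in> Capl2_span n"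
  shows "delta n k b (delta n l c f) = delta n l c (delta n k b f)"
  using assms(3)
proof (induction rule: Capl2_span.induct)
  case (gen y y')
  let ?f = "\<lambda>x t. Capl n x y * Capl n t y'"
  let ?g = "\<lambda>x t. \<Sum>S\<in>ksubsets n l. \<Sum>T\<in>ksubsets n k. Capl n (scale_on c S x) y * Capl n (scale_on b T t) y'"
  have "delta n k b (delta n l c ?f) = ?g"
  proof (intro ext)
    fix x t
    \<comment> \<open>In this order \<open>b\<close> is applied to \<open>x\<close> underneath
      \<open>c\<close>. Writing \<open>c\<close> into the coefficients first frees \<open>b\<close>
      for the transfer; in the other order the transfer applies at once.\<close>
    have "delta n k b (delta n l c ?f) x t =
      (\<Sum>P\<in>ksubsets n l. \<Sum>T\<in>ksubsets n k. Capl n (scale_on b T x) (scale_gaps c P y) * Capl n t y')"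
      unfolding delta_gen unfolding delta_def by (rule sum.swap)
    also have "\<dots> = (\<Sum>P\<in>ksubsets n l. \<Sum>T\<in>ksubsets n k. Capl n x (scale_gaps c P y) * Capl n (scale_on b T t) y')"
      by (simp only: Capl_transfer[OF cap])
    also have "\<dots> = (\<Sum>P\<in>ksubsets n l. Capl n x (scale_gaps c P y)) * (\<Sum>T\<in>ksubsets n k. Capl n (scale_on b T t) y')"
      by (simp only: sum_product)
    also have "\<dots> = ?g x t"
      by (simp only: sum_Capl_scale_on[where k = l and b = c, symmetric] sum_product)
    finally show "delta n k b (delta n l c ?f) x t = ?g x t" .
  qed
  moreover have "delta n l c (delta n k b ?f) = ?g"
    unfolding delta_def by (intro ext sum.cong[OF refl] Capl_transfer[OF cap])
  ultimately show ?case by simp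
qed (simp_all add: delta_add delta_zero)

section \<open>The Cayley--Hamilton identity\<close>

text \<open>The identity \<open>Cap\<close> of degree \<open>n + 1\<close>, with \<open>w\<close> as
  an additional variable of index 0, is expanded by the variable that stands first. It plays the
  role of Cramer's rule.\<close>

lemma mult_Capl_exchange:
  fixes x y :: "nat \<Rightarrow> 'a::ring_1"
  assumes cap: "satisfies_Cap (n + 1) TYPE('a)"
  shows "w * Capl n x y = (\<Sum>i=1..n. x i * Capl n (x(i := w)) y)"
proof -
  define z where "z = x(0 := w)"
  have upt: "[0..<n+1] = 0 # [1..<n+1]" by (subst upt_conv_Cons) auto
  have set: "set [0..<n+1] = insert 0 {1..n}" by auto
  have fact: "alt_term [0..<n+1] z y (transpose 0 i \<circ> q) =
      of_int (sign (transpose 0 i)) * (z i * (of_int (sign q) * (y 0 * prod_list (map (\<lambda>j. (z \<circ> transpose 0 i) (q j) * y j) [1..<n+1]))))"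
    if i: "i \<in> insert 0 {1..n}" and q: "q permutes {1..n}" for i q
  proof -
    have "sign (transpose 0 i \<circ> q) = sign (transpose 0 i) * sign q"
      using i q permutes_swap_id[of 0 "insert 0 {1..n}" i]
      by (intro sign_compose) (auto intro: permutes_imp_permutation[rotated])
    moreover have "q 0 = 0" by (rule permutes_not_in[OF q]) simp
    moreover have "of_int (sign q) * (z i * v) = z i * (of_int (sign q) * v)" for v
      by (metis mult.assoc mult_of_int_commute)
    ultimately show ?thesis
      unfolding alt_term_def upt by (simp add: mult.assoc del: upt_Suc)
  qed
  have "0 = altprod [0..<n+1] z y"
    by (rule altprod_eq_0[OF cap, symmetric]) auto
  also have "\<dots> = (\<Sum>i\<in>insert 0 {1..n}. \<Sum>q | q permutes {1..n}. alt_term [0..<n+1] z y (transpose 0 i \<circ> q))"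
    unfolding altprod_alt_term set by (rule sum_over_permutations_insert) auto
  also have "\<dots> = (\<Sum>i\<in>insert 0 {1..n}. of_int (sign (transpose 0 i)) * (z i * Capl n (z \<circ> transpose 0 i) y))"
    unfolding Capl_sum sum_distrib_left by (intro sum.cong[OF refl]) (simp only: fact mem_Collect_eq)
  \<comment> \<open>For \<open>i \<ge> 1\<close> the transposition has sign -1, brings
    \<open>x i\<close> to the front and puts \<open>w\<close> in its place.\<close>
  also have "\<dots> = w * Capl n x y + (\<Sum>i=1..n. - (x i * Capl n (x(i := w)) y))"
  proof -
    have Capl_cong: "Capl n a y = Capl n b y" if "\<And>i. i \<in> {1..n} \<Longrightarrow> a i = b i" for a b
      unfolding Capl_def Cap_eq_altprod using that by (auto intro!: arg_cong2[where f = times] altprod_cong)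
    have "Capl n z y = Capl n x y" by (rule Capl_cong) (auto simp: z_def)
    moreover have "Capl n (z \<circ> transpose 0 i) y = Capl n (x(i := w)) y" if "i \<in> {1..n}" for i
      using that by (intro Capl_cong) (auto simp: z_def transpose_def)
    moreover have "of_int (sign (transpose 0 i)) = (-1 :: 'a)" "z i = x i" if "i \<in> {1..n}" for i
      using that by (auto simp: sign_swap_id z_def)
    moreover have "Capl n (z \<circ> transpose 0 0) y = Capl n z y" by simp
    ultimately have "(\<Sum>i=1..n. of_int (sign (transpose 0 i)) * (z i * Capl n (z \<circ> transpose 0 i) y)) =
        (\<Sum>i=1..n. - (x i * Capl n (x(i := w)) y))"
      by (intro sum.cong[OF refl]) (simp only: mult_minus1)
    moreover have "of_int (sign (transpose 0 (0::nat))) * (z 0 * Capl n (z \<circ> transpose 0 0) y) = w * Capl n x y"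
      using \<open>Capl n z y = Capl n x y\<close> by (simp add: z_def)
    ultimately show ?thesis by (subst sum.insert) auto
  qed
  finally show ?thesis by (simp add: sum_negf)
qed

text \<open>The exchange formula with \<open>w = 1\<close> turns the alternating sum into a telescoping one.\<close>

lemma Cayley_Hamilton_Capl:
  fixes x y :: "nat \<Rightarrow> 'a::ring_1"
  assumes cap: "satisfies_Cap (n + 1) TYPE('a)"
  shows "(\<Sum>k\<le>n. (-1) ^ k * b ^ (n - k) * (\<Sum>S\<in>ksubsets n k. Capl n (scale_on b S x) y)) = 0"
proof -
  \<comment> \<open>For \<open>i\<close> outside \<open>S\<close>, \<open>g S i\<close> is the
    exchange term that has \<open>x i\<close> in front and 1 in its place; \<open>H k\<close>
    collects these terms.\<close>
  define g where "g S i = x i * Capl n ((scale_on b S x)(i := 1)) y" for S i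
  define P where "P k = (\<Sum>S\<in>ksubsets n k. Capl n (scale_on b S x) y)" for k
  define H where "H k = (\<Sum>S\<in>ksubsets n k. \<Sum>i\<in>{1..n} - S. g S i)" for k
  note fin = finite_of_ksubsets
  have Capl: "Capl n (scale_on b S x) y = (\<Sum>i\<in>{1..n} - S. g S i) + b * (\<Sum>i\<in>S. g (S - {i}) i)"
    if S: "S \<in> ksubsets n k" for S k
  proof -
    have "Capl n (scale_on b S x) y = (\<Sum>i=1..n. scale_on b S x i * Capl n ((scale_on b S x)(i := 1)) y)"
      using mult_Capl_exchange[OF cap, of 1 "scale_on b S x" y] unfolding mult_1_left .
    also have "\<dots> = (\<Sum>i\<in>{1..n} - S. scale_on b S x i * Capl n ((scale_on b S x)(i := 1)) y) +
        (\<Sum>i\<in>S. scale_on b S x i * Capl n ((scale_on b S x)(i := 1)) y)"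
      using S by (intro sum.subset_diff) (auto simp: ksubsets_def)
    also have "(\<Sum>i\<in>{1..n} - S. scale_on b S x i * Capl n ((scale_on b S x)(i := 1)) y) = (\<Sum>i\<in>{1..n} - S. g S i)"
      by (rule sum.cong[OF refl]) (auto simp: g_def scale_on_def)
    \<comment> \<open>For \<open>i \<in> S\<close> the front factor is \<open>b * x i\<close>, so
      \<open>b\<close> comes off on the left. Entry \<open>i\<close> itself is overwritten by 1,
      hence \<open>S\<close> may be replaced by \<open>S - {i}\<close>.\<close>
    also have "(\<Sum>i\<in>S. scale_on b S x i * Capl n ((scale_on b S x)(i := 1)) y) = (\<Sum>i\<in>S. b * g (S - {i}) i)"
    proof (rule sum.cong[OF refl])
      fix i assume i: "i \<in> S"
      have "(scale_on b S x)(i := 1) = (scale_on b (S - {i}) x)(i := 1)"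
        by (auto simp: scale_on_def)
      then show "scale_on b S x i * Capl n ((scale_on b S x)(i := 1)) y = b * g (S - {i}) i"
        using i by (simp add: g_def mult.assoc) (simp add: scale_on_def mult.assoc)
    qed
    finally show ?thesis by (simp add: sum_distrib_left)
  qed
  have P0: "P 0 = H 0"
    unfolding P_def H_def using Capl[of "{}" 0] by (simp add: ksubsets_0)
  have ins: "insert i S \<in> ksubsets n (Suc k)" if "S \<in> ksubsets n k" "i \<in> {1..n} - S" for S i k
    using that fin[OF that(1)] by (auto simp: ksubsets_def)
  have del: "S - {i} \<in> ksubsets n k \<and> i \<in> {1..n} - (S - {i})"
    if "S \<in> ksubsets n (Suc k)" "i \<in> S" for S i k
    using that fin[OF that(1)] by (auto simp: ksubsets_def)
  have PS: "P (Suc k) = H (Suc k) + b * H k" for k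
  proof -
    have "(\<Sum>S\<in>ksubsets n (Suc k). \<Sum>i\<in>S. g (S - {i}) i) =
        (\<Sum>(S, i)\<in>Sigma (ksubsets n (Suc k)) (\<lambda>S. S). g (S - {i}) i)"
      using fin by (intro sum.Sigma) auto
    \<comment> \<open>Removing \<open>i\<close> from \<open>S\<close> matches the pairs with
      \<open>i\<close> inside a \<open>Suc k\<close>-subset and those with \<open>i\<close> outside
      a \<open>k\<close>-subset.\<close>
    also have "\<dots> = (\<Sum>(S, i)\<in>Sigma (ksubsets n k) (\<lambda>S. {1..n} - S). g S i)"
    proof (rule sum.reindex_bij_witness[where
          i = "\<lambda>(S, i). (insert i S, i)" and j = "\<lambda>(S, i). (S - {i}, i)"])
      fix A assume A: "A \<in> Sigma (ksubsets n (Suc k)) (\<lambda>S. S)"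
      show "(case A of (S, i) \<Rightarrow> (S - {i}, i)) \<in> Sigma (ksubsets n k) (\<lambda>S. {1..n} - S)"
      proof -
        obtain S i where "A = (S, i)" by (cases A)
        then show ?thesis using A del[of S k i] by simp
      qed
    next
      fix A assume A: "A \<in> Sigma (ksubsets n k) (\<lambda>S. {1..n} - S)"
      show "(case A of (S, i) \<Rightarrow> (insert i S, i)) \<in> Sigma (ksubsets n (Suc k)) (\<lambda>S. S)"
      proof -
        obtain S i where "A = (S, i)" by (cases A)
        then show ?thesis using A ins[of S k i] by simp
      qed
    qed auto
    also have "\<dots> = H k"
      unfolding H_def using fin by (intro sum.Sigma[symmetric]) auto
    finally have "(\<Sum>S\<in>ksubsets n (Suc k). \<Sum>i\<in>S. g (S - {i}) i) = H k" .
    then show ?thesis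
      unfolding P_def H_def[of "Suc k"]
      by (simp add: Capl sum.distrib sum_distrib_left[symmetric])
  qed
  have tele: "(\<Sum>k\<le>m. (-1) ^ k * b ^ (n - k) * P k) = (-1) ^ m * b ^ (n - m) * H m" if "m \<le> n" for m
    using that
  proof (induction m)
    case 0
    show ?case by (simp add: P0)
  next
    case (Suc m)
    then have "b ^ (n - m) = b ^ (n - Suc m) * b"
      by (metis Suc_diff_le Suc_le_lessD power_Suc2 diff_Suc_Suc)
    then show ?case using Suc by (simp add: PS distrib_left mult.assoc)
  qed
  \<comment> \<open>Only the last \<open>H\<close> survives the telescoping, and no index lies
    outside the full set.\<close>
  have "H n = 0"
    unfolding H_def
  proof (rule sum.neutral, rule ballI)
    fix S assume "S \<in> ksubsets n n"
    then have "S = {1..n}" using card_subset_eq[of "{1..n}" S] by (simp add: ksubsets_def)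
    then show "(\<Sum>i\<in>{1..n} - S. g S i) = 0" by simp
  qed
  then show ?thesis using tele[of n] by (simp add: P_def)
qed

lemma Cayley_Hamilton_delta:
  fixes f :: "(nat \<Rightarrow> 'a::ring_1) \<Rightarrow> (nat \<Rightarrow> 'a) \<Rightarrow> 'a"
  assumes cap: "satisfies_Cap (n + 1) TYPE('a)" and "f \<in> Capl2_span n"
  shows "(\<Sum>k\<le>n. (-1) ^ k * b ^ (n - k) * delta n k b f x t) = 0"
  using assms(2)
proof (induction rule: Capl2_span.induct)
  case (gen y y')
  then show ?case
    using arg_cong[OF Cayley_Hamilton_Capl[OF cap, of b x y], of "\<lambda>v. v * Capl n t y'"]
    by (simp add: delta_def sum_distrib_right[symmetric] mult.assoc[symmetric])
next
  case (add f g)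
  then show ?case by (simp add: delta_add distrib_left sum.distrib)
qed (simp add: delta_zero)

section \<open>The action of the polynomial ring\<close>

text \<open>The operators commute only on the span; extending them by the identity makes
  \<^const>\<open>fold_mset\<close> applicable.\<close>

definition xi_op ::
  "nat \<Rightarrow> nat \<times> 'a::ring_1 \<Rightarrow> ((nat \<Rightarrow> 'a) \<Rightarrow> (nat \<Rightarrow> 'a) \<Rightarrow> 'a) \<Rightarrow> (nat \<Rightarrow> 'a) \<Rightarrow> (nat \<Rightarrow> 'a) \<Rightarrow> 'a" where
  "xi_op n v f = (if f \<in> Capl2_span n then (\<lambda>x t. (-1) ^ fst v * delta n (fst v) (snd v) f x t) else f)"

text \<open>A monomial is read as the multiset of its indeterminates, over which the operators are
  folded.\<close>

definition monom_act ::
  "nat \<Rightarrow> (nat \<times> 'a::ring_1 \<Rightarrow>\<^sub>0 nat) \<Rightarrow> ((nat \<Rightarrow> 'a) \<Rightarrow> (nat \<Rightarrow> 'a) \<Rightarrow> 'a) \<Rightarrow> (nat \<Rightarrow> 'a) \<Rightarrow> (nat \<Rightarrow> 'a) \<Rightarrow> 'a" where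
  "monom_act n m f = fold_mset (xi_op n) f (Abs_multiset (Poly_Mapping.lookup m))"

definition poly_act ::
  "nat \<Rightarrow> 'a::ring_1 xpoly \<Rightarrow> ((nat \<Rightarrow> 'a) \<Rightarrow> (nat \<Rightarrow> 'a) \<Rightarrow> 'a) \<Rightarrow> (nat \<Rightarrow> 'a) \<Rightarrow> (nat \<Rightarrow> 'a) \<Rightarrow> 'a" where
  "poly_act n p f = (\<lambda>x t. \<Sum>m\<in>Poly_Mapping.keys p. Poly_Mapping.lookup p m * monom_act n m f x t)"

lemma xi_op_in_Capl2_span: "f \<in> Capl2_span n \<Longrightarrow> xi_op n v f \<in> Capl2_span n"
  by (simp add: xi_op_def Capl2_span_mult_left delta_in_Capl2_span)

lemma xi_op_add:
  "f \<in> Capl2_span n \<Longrightarrow> g \<in> Capl2_span n \<Longrightarrow>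
   xi_op n v (\<lambda>x t. f x t + g x t) = (\<lambda>x t. xi_op n v f x t + xi_op n v g x t)"
  by (simp add: xi_op_def Capl2_span.add delta_add distrib_left)

lemma minus_one_power_commute: "(-1) ^ k * a = a * (-1) ^ k" for a :: "'a::ring_1"
  by (cases "even k") auto

lemma xi_op_mult_left:
  "f \<in> Capl2_span n \<Longrightarrow> xi_op n v (\<lambda>x t. a * f x t) = (\<lambda>x t. a * xi_op n v f x t)"
  by (simp add: xi_op_def Capl2_span_mult_left delta_mult_left mult.assoc[symmetric] minus_one_power_commute[of _ a])

lemma comp_fun_commute_xi_op:
  assumes "satisfies_Cap (n + 1) TYPE('a::ring_1)" "n \<ge> 1"
  shows "comp_fun_commute (xi_op n :: nat \<times> 'a \<Rightarrow> _)"
proof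
  fix u v :: "nat \<times> 'a"
  have "xi_op n v (xi_op n u f) = xi_op n u (xi_op n v f)" for f
  proof (cases "f \<in> Capl2_span n")
    case True
    then have "xi_op n v (xi_op n u f) = (\<lambda>x t. (-1) ^ (fst v + fst u) *
        delta n (fst v) (snd v) (delta n (fst u) (snd u) f) x t)" for u v :: "nat \<times> 'a"
      by (simp add: xi_op_def Capl2_span_mult_left delta_in_Capl2_span delta_mult_left
          power_add mult.assoc)
    then show ?thesis
      by (simp only: delta_commute[OF assms True, of "fst v" "snd v"] add.commute)
  qed (simp add: xi_op_def)
  then show "xi_op n v \<circ> xi_op n u = xi_op n u \<circ> xi_op n v" by auto
qed

lemma count_Abs_multiset_lookup: "count (Abs_multiset (Poly_Mapping.lookup m)) = Poly_Mapping.lookup m"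
  for m :: "'v \<Rightarrow>\<^sub>0 nat"
  by (rule count_Abs_multiset) simp

lemma Abs_multiset_lookup_add:
  "Abs_multiset (Poly_Mapping.lookup (m + m')) =
   Abs_multiset (Poly_Mapping.lookup m) + Abs_multiset (Poly_Mapping.lookup m')"
  for m m' :: "'v \<Rightarrow>\<^sub>0 nat"
  by (rule multiset_eqI) (simp add: count_Abs_multiset_lookup lookup_add)

lemma Abs_multiset_lookup_single:
  "Abs_multiset (Poly_Mapping.lookup (Poly_Mapping.single v (1::nat))) = {#v#}"
  by (rule multiset_eqI) (simp add: count_Abs_multiset_lookup lookup_single when_def)

lemma Abs_multiset_lookup_zero:
  "Abs_multiset (Poly_Mapping.lookup (0 :: 'v \<Rightarrow>\<^sub>0 nat)) = {#}"
  by (rule multiset_eqI) (simp add: count_Abs_multiset_lookup)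

lemma poly_mapping_eq_sum_single:
  fixes p :: "'k \<Rightarrow>\<^sub>0 'b::comm_monoid_add"
  shows "p = (\<Sum>k\<in>Poly_Mapping.keys p. Poly_Mapping.single k (Poly_Mapping.lookup p k))"
  by (rule poly_mapping_eqI)
     (simp add: lookup_sum lookup_single when_def sum.delta in_keys_iff)

lemma poly_act_superset:
  assumes "finite A" "Poly_Mapping.keys p \<subseteq> A"
  shows "poly_act n p f = (\<lambda>x t. \<Sum>m\<in>A. Poly_Mapping.lookup p m * monom_act n m f x t)"
  unfolding poly_act_def using assms
  by (intro ext sum.mono_neutral_left) (auto simp: in_keys_iff)

lemma poly_act_add: "poly_act n (p + q) f = (\<lambda>x t. poly_act n p f x t + poly_act n q f x t)"
proof -
  let ?A = "Poly_Mapping.keys p \<union> Poly_Mapping.keys q"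
  have "poly_act n (p + q) f = (\<lambda>x t. \<Sum>m\<in>?A. Poly_Mapping.lookup (p + q) m * monom_act n m f x t)"
    using Poly_Mapping.keys_add[of p q] by (intro poly_act_superset) auto
  then show ?thesis
    by (simp add: poly_act_superset[of ?A p] poly_act_superset[of ?A q] lookup_add distrib_right sum.distrib)
qed

lemma poly_act_zero: "poly_act n 0 f = (\<lambda>x t. 0)"
  by (simp add: poly_act_def)

lemma poly_act_sum: "finite I \<Longrightarrow> poly_act n (\<Sum>i\<in>I. p i) f = (\<lambda>x t. \<Sum>i\<in>I. poly_act n (p i) f x t)"
  by (induction I rule: finite_induct) (simp_all add: poly_act_zero poly_act_add)

lemma poly_act_single: "poly_act n (Poly_Mapping.single m a) f = (\<lambda>x t. a * monom_act n m f x t)"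
  by (subst poly_act_superset[of "{m}"]) auto

section \<open>Compatibility of the action with sums, products and generators\<close>

context
  fixes n :: nat
  assumes cap: "satisfies_Cap (n + 1) TYPE('a::ring_1)" and n: "n \<ge> 1"
begin

interpretation comp_fun_commute "xi_op n :: nat \<times> 'a \<Rightarrow> _"
  by (rule comp_fun_commute_xi_op[OF cap n])

lemma fold_xi_op_in_Capl2_span:
  "f \<in> Capl2_span n \<Longrightarrow> fold_mset (xi_op n) f M \<in> Capl2_span n" for M :: "(nat \<times> 'a) multiset"
  by (induction M) (simp_all add: xi_op_in_Capl2_span)

lemma fold_xi_op_add:
  "f \<in> Capl2_span n \<Longrightarrow> g \<in> Capl2_span n \<Longrightarrow> fold_mset (xi_op n) (\<lambda>x t. f x t + g x t) M =
   (\<lambda>x t. fold_mset (xi_op n) f M x t + fold_mset (xi_op n) g M x t)" for M :: "(nat \<times> 'a) multiset"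
  by (induction M) (simp_all add: xi_op_add fold_xi_op_in_Capl2_span)

lemma fold_xi_op_mult_left:
  "f \<in> Capl2_span n \<Longrightarrow> fold_mset (xi_op n) (\<lambda>x t. a * f x t) M =
   (\<lambda>x t. a * fold_mset (xi_op n) f M x t)" for M :: "(nat \<times> 'a) multiset"
  by (induction M) (simp_all add: xi_op_mult_left fold_xi_op_in_Capl2_span)

lemma monom_act_in_Capl2_span: "f \<in> Capl2_span n \<Longrightarrow> monom_act n m f \<in> Capl2_span n"
  for f :: "(nat \<Rightarrow> 'a) \<Rightarrow> _"
  by (simp add: monom_act_def fold_xi_op_in_Capl2_span)

lemma monom_act_add:
  "f \<in> Capl2_span n \<Longrightarrow> g \<in> Capl2_span n \<Longrightarrow>
   monom_act n m (\<lambda>x t. f x t + g x t) = (\<lambda>x t. monom_act n m f x t + monom_act n m g x t)"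
  for f :: "(nat \<Rightarrow> 'a) \<Rightarrow> _"
  by (simp add: monom_act_def fold_xi_op_add)

lemma monom_act_mult_left:
  "f \<in> Capl2_span n \<Longrightarrow> monom_act n m (\<lambda>x t. a * f x t) = (\<lambda>x t. a * monom_act n m f x t)"
  for f :: "(nat \<Rightarrow> 'a) \<Rightarrow> _"
  by (simp add: monom_act_def fold_xi_op_mult_left)

lemma monom_act_zero: "monom_act n m (\<lambda>x t. 0) = (\<lambda>x t. 0 :: 'a)"
  using monom_act_mult_left[OF Capl2_span.zero, of m 0] by simp

lemma monom_act_sum:
  fixes f :: "'i \<Rightarrow> (nat \<Rightarrow> 'a) \<Rightarrow> _"
  assumes "finite I" "\<And>i. i \<in> I \<Longrightarrow> f i \<in> Capl2_span n"
  shows "monom_act n m (\<lambda>x t. \<Sum>i\<in>I. f i x t) = (\<lambda>x t. \<Sum>i\<in>I. monom_act n m (f i) x t)"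
  using assms
  by (induction I rule: finite_induct)
     (simp_all add: monom_act_zero monom_act_add Capl2_span_sum)

lemma monom_act_monom_act: "monom_act n (m + m') f = monom_act n m (monom_act n m' f)"
  for f :: "(nat \<Rightarrow> 'a) \<Rightarrow> _"
  unfolding monom_act_def Abs_multiset_lookup_add by (metis add.commute fold_mset_union)

lemma poly_act_in_Capl2_span: "f \<in> Capl2_span n \<Longrightarrow> poly_act n p f \<in> Capl2_span n"
  for f :: "(nat \<Rightarrow> 'a) \<Rightarrow> _"
  unfolding poly_act_def
  by (intro Capl2_span_sum Capl2_span_mult_left monom_act_in_Capl2_span) auto

text \<open>The coefficients of \<open>q\<close> must pass through the monomials of
  \<open>p\<close>. They do, since the operators substitute in the variables while coefficients
  multiply from the left.\<close>

lemma poly_act_mult: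
  fixes f :: "(nat \<Rightarrow> 'a) \<Rightarrow> (nat \<Rightarrow> 'a) \<Rightarrow> 'a"
  assumes f: "f \<in> Capl2_span n"
  shows "poly_act n (p * q) f = poly_act n p (poly_act n q f)"
proof -
  let ?l = Poly_Mapping.lookup and ?s = Poly_Mapping.single
  let ?P = "Poly_Mapping.keys p" and ?Q = "Poly_Mapping.keys q"
  have "p * q = (\<Sum>m\<in>?P. \<Sum>m'\<in>?Q. ?s (m + m') (?l p m * ?l q m'))"
    by (subst poly_mapping_eq_sum_single[of p], subst poly_mapping_eq_sum_single[of q])
       (simp add: sum_product mult_single)
  then have "poly_act n (p * q) f =
      (\<lambda>x t. \<Sum>m\<in>?P. \<Sum>m'\<in>?Q. ?l p m * (?l q m' * monom_act n m (monom_act n m' f) x t))"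
    by (simp add: poly_act_sum poly_act_single monom_act_monom_act mult.assoc)
  also have "\<dots> = (\<lambda>x t. \<Sum>m\<in>?P. ?l p m * monom_act n m (poly_act n q f) x t)"
    unfolding poly_act_def[of n q f] using f
    by (simp add: monom_act_sum monom_act_mult_left monom_act_in_Capl2_span Capl2_span_mult_left
        sum_distrib_left)
  finally show ?thesis by (simp add: poly_act_def)
qed

lemma poly_act_const: "poly_act n (const_poly a) f = (\<lambda>x t. a * f x t)"
  for f :: "(nat \<Rightarrow> 'a) \<Rightarrow> _"
  by (simp add: const_poly_def poly_act_single monom_act_def Abs_multiset_lookup_zero)

lemma poly_act_char_gen:
  fixes f :: "(nat \<Rightarrow> 'a) \<Rightarrow> (nat \<Rightarrow> 'a) \<Rightarrow> 'a"
  assumes f: "f \<in> Capl2_span n"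
  shows "poly_act n (char_gen n b) f = (\<lambda>x t. 0)"
proof (intro ext)
  fix x t
  have mon: "poly_act n (xi i b * const_poly (b ^ (n - i))) f x t =
      (-1) ^ i * b ^ (n - i) * delta n i b f x t" for i
    using f by (simp add: xi_def const_poly_def mult_single poly_act_single monom_act_def
        Abs_multiset_lookup_single[simplified] xi_op_def mult.assoc[symmetric]
        minus_one_power_commute[of i "b ^ (n - i)"])
  \<comment> \<open>The constant \<open>b ^ n\<close> in \<open>char_gen\<close> is the term
    \<open>k = 0\<close> of the Cayley-Hamilton sum.\<close>
  have "delta n 0 b f x t = f x t"
    by (simp add: delta_def ksubsets_0 scale_on_def)
  moreover have "{..n} = insert 0 {1..n}" by auto
  ultimately show "poly_act n (char_gen n b) f x t = 0"
    using Cayley_Hamilton_delta[OF cap f, of b x t]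
    by (simp add: char_gen_def poly_act_add poly_act_const poly_act_sum mon)
qed

end

section \<open>Annihilation of the span by the ideal of the obstruction\<close>

lemma PR_add: "p \<in> PR n \<Longrightarrow> q \<in> PR n \<Longrightarrow> p + q \<in> PR n"
  using Poly_Mapping.keys_add[of p q] unfolding PR_def by blast

lemma PR_uminus: "p \<in> PR n \<Longrightarrow> - p \<in> PR n"
  by (simp add: PR_def in_keys_iff)

lemma PR_mult:
  assumes "p \<in> PR n" "q \<in> PR n"
  shows "p * q \<in> PR n"
  unfolding PR_def
proof (clarify, rename_tac m i a)
  fix m i a
  assume "m \<in> Poly_Mapping.keys (p * q)" and v: "(i, a) \<in> Poly_Mapping.keys m"
  then obtain m1 m2 where m: "m = m1 + m2" "m1 \<in> Poly_Mapping.keys p" "m2 \<in> Poly_Mapping.keys q"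
    using Poly_Mapping.keys_mult[of p q] by blast
  then have "(i, a) \<in> Poly_Mapping.keys m1 \<or> (i, a) \<in> Poly_Mapping.keys m2"
    using v Poly_Mapping.keys_add[of m1 m2] by blast
  then show "1 \<le> fst (i, a) \<and> fst (i, a) \<le> n"
    using m assms unfolding PR_def by blast
qed

lemma PR_single:
  assumes "\<And>v. v \<in> Poly_Mapping.keys m \<Longrightarrow> 1 \<le> fst v \<and> fst v \<le> n"
  shows "Poly_Mapping.single m a \<in> PR n"
  using assms by (auto simp: PR_def)

lemma char_gen_in_PR: "char_gen n a \<in> PR n"
proof -
  have zero: "0 \<in> PR n" by (simp add: PR_def)
  have sum: "(\<Sum>i\<in>I. p i) \<in> PR n" if "finite I" "\<And>i. i \<in> I \<Longrightarrow> p i \<in> PR n"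
    for I :: "nat set" and p :: "nat \<Rightarrow> 'a xpoly"
    using that by (induction I rule: finite_induct) (auto simp: zero intro: PR_add)
  have const: "const_poly c \<in> PR n" for c :: 'a
    unfolding const_poly_def by (rule PR_single) simp
  have "xi i a \<in> PR n" if "i \<in> {1..n}" for i
    unfolding xi_def using that by (intro PR_single) auto
  then show ?thesis
    unfolding char_gen_def by (intro PR_add const sum PR_mult) auto
qed

text \<open>The annihilator \<open>J\<close> of the span within \<open>PR n\<close> is a two-sided
  ideal containing the generators. Left factors then act on the zero function, and right factors map
  the span to itself.\<close>

lemma poly_act_I_ideal:
  fixes p :: "'a::ring_1 xpoly"
  assumes cap: "satisfies_Cap (n + 1) TYPE('a)" and n: "n \<ge> 1"
    and p: "p \<in> I_ideal n" and f: "f \<in> Capl2_span n"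
  shows "poly_act n p f = (\<lambda>x t. 0)"
proof -
  define J where "J = {p :: 'a xpoly. p \<in> PR n \<and> (\<forall>f\<in>Capl2_span n. poly_act n p f = (\<lambda>x t. 0))}"
  note mult = poly_act_mult[OF cap n]
  have zero: "poly_act n p (\<lambda>x t. 0) = (\<lambda>x t. 0 :: 'a)" for p
    by (simp add: poly_act_def monom_act_zero[OF cap n])
  have "poly_act n (- p) f = (\<lambda>x t. 0)" if "poly_act n p f = (\<lambda>x t. 0)" for p :: "'a xpoly" and f
    using poly_act_add[of n p "- p" f] that by (simp add: poly_act_zero fun_eq_iff)
  then have "is_ideal_in (PR n) J"
    unfolding is_ideal_in_def J_def
    by (auto simp: poly_act_zero poly_act_add mult zero poly_act_in_Capl2_span[OF cap n]
        intro: PR_add PR_uminus PR_mult) (simp add: PR_def)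
  moreover have "range (char_gen n) \<subseteq> J"
    using poly_act_char_gen[OF cap n] by (auto simp: J_def char_gen_in_PR)
  ultimately have "I_ideal n \<subseteq> J"
    unfolding I_ideal_def ideal_gen_in_def by blast
  then show ?thesis using p f by (auto simp: J_def)
qed

section \<open>From Capelli values to the ideals they generate\<close>

lemma Obst_mult_Capl:
  fixes a :: "'a::ring_1"
  assumes "satisfies_Cap (n + 1) TYPE('a)" "n \<ge> 1" "a \<in> Obst n"
  shows "a * (Capl n x y * Capl n t y') = 0"
proof -
  \<comment> \<open>\<open>const_poly a\<close> lies in the ideal and so acts as zero, while its
    action is left multiplication by \<open>a\<close>.\<close>
  have "(\<lambda>x t. a * (Capl n x y * Capl n t y')) = (\<lambda>x t. 0)"
    using poly_act_I_ideal[OF assms(1,2) _ Capl2_span.gen, of "const_poly a" y y'] assms(3)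
    by (simp add: poly_act_const[OF assms(1,2)] Obst_def)
  then show ?thesis by (meson fun_cong)
qed

lemma mult_ideal_mult_eq_0:
  assumes "\<And>u v. u \<in> I \<Longrightarrow> v \<in> J \<Longrightarrow> a * (u * v) = 0" and "w \<in> ideal_mult I J"
  shows "a * w = 0"
  using assms by (auto simp: ideal_mult_def sum_distrib_left intro!: sum.neutral)

lemma ideal_gen_subset: "is_ideal I \<Longrightarrow> S \<subseteq> I \<Longrightarrow> ideal_gen S \<subseteq> I"
  by (auto simp: ideal_gen_def)

text \<open>Arbitrary ring elements may stand before each Capelli value, so the vanishing extends to
  the generated ideals, first in \<open>v\<close> and then in \<open>u\<close>.\<close>

lemma Obst_mult_CAP_CAP:
  fixes a u v :: "'a::ring_1"
  assumes cap: "satisfies_Cap (n + 1) TYPE('a)" "n \<ge> 1" and a: "a \<in> Obst n"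
    and u: "u \<in> CAP n" and v: "v \<in> CAP n"
  shows "a * (u * v) = 0"
proof -
  have Cap: "a * r * Cap n x y * s * Cap n t y' = 0" for r s x y t y'
  proof -
    \<comment> \<open>\<open>Cap\<close> does not see index 0, so \<open>y 0\<close> and
      \<open>y' 0\<close> may be chosen as \<open>r\<close> and \<open>s\<close>.\<close>
    have "Cap n x (y(0 := r)) = Cap n x y" "Cap n t (y'(0 := s)) = Cap n t y'"
      unfolding Cap_eq_altprod by (rule altprod_cong; auto)+
    then show ?thesis
      using Obst_mult_Capl[OF cap a, of x "y(0 := r)" t "y'(0 := s)"]
      by (simp add: Capl_def mult.assoc)
  qed
  \<comment> \<open>The quantified \<open>s\<close> absorbs a left factor of \<open>v\<close>; in
    \<open>?K\<close> below, \<open>r\<close> and \<open>s\<close> absorb the factors on either side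
    of \<open>u\<close>.\<close>
  let ?I = "{v. \<forall>r x y s. a * r * Cap n x y * s * v = 0}"
  have "is_ideal ?I"
  proof -
    have "a * r * Cap n x y * s * (c * v) = 0" if "v \<in> ?I" for r x y s c v
      using that[simplified, rule_format, of r x y "s * c"] by (simp add: mult.assoc)
    moreover have "a * r * Cap n x y * s * (v * c) = 0" if "v \<in> ?I" for r x y s c v
      using that[simplified, rule_format, of r x y s] by (simp add: mult.assoc[symmetric])
    ultimately show ?thesis by (auto simp: is_ideal_def distrib_left)
  qed
  moreover have "{Cap n x y |x y. True} \<subseteq> ?I" using Cap by auto
  ultimately have "CAP n \<subseteq> ?I" unfolding CAP_def by (rule ideal_gen_subset)
  then have v': "a * r * Cap n x y * s * v = 0" for r x y s
    using v by blast
  let ?K = "{u. \<forall>r s. a * r * u * s * v = 0}"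
  have "is_ideal ?K"
  proof -
    have "a * r * (c * u) * s * v = 0" if "u \<in> ?K" for r s c u
      using that[simplified, rule_format, of "r * c" s] by (simp add: mult.assoc)
    moreover have "a * r * (u * c) * s * v = 0" if "u \<in> ?K" for r s c u
      using that[simplified, rule_format, of r "c * s"] by (simp add: mult.assoc)
    ultimately show ?thesis by (auto simp: is_ideal_def distrib_left distrib_right)
  qed
  moreover have "{Cap n x y |x y. True} \<subseteq> ?K" using v' by auto
  ultimately have "CAP n \<subseteq> ?K" unfolding CAP_def by (rule ideal_gen_subset)
  then have "a * 1 * u * 1 * v = 0" using u by blast
  then show ?thesis by (simp add: mult.assoc)
qed

theorem theorem2p36:
  fixes phi :: "'c::comm_ring_1 \<Rightarrow> 'a::ring_1"
    and gens :: "'a list" and n :: nat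
  assumes "central_hom phi"
    and "subalg_gen phi (set gens) = UNIV"
    and "n \<ge> 1"
    and "satisfies_Cap (n + 1) TYPE('a)"
  shows "ideal_mult (Obst n :: 'a set) (ideal_mult (CAP n) (CAP n)) = {0}"
proof (intro equalityI subsetI)
  fix w :: 'a assume w: "w \<in> ideal_mult (Obst n) (ideal_mult (CAP n) (CAP n))"
  \<comment> \<open>The factor 1 gives the claim the shape \<open>a * (u * v) = 0\<close>, so that
    \<open>mult_ideal_mult_eq_0\<close> serves for the outer product as well.\<close>
  have "1 * (a * b) = 0" if "a \<in> Obst n" "b \<in> ideal_mult (CAP n) (CAP n)" for a b :: 'a
    using mult_ideal_mult_eq_0[OF Obst_mult_CAP_CAP[OF assms(4,3) that(1)] that(2)] by simp
  then have "1 * w = 0" using w by (rule mult_ideal_mult_eq_0)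
  then show "w \<in> {0}" by simp
next
  fix w :: 'a assume "w \<in> {0}"
  then show "w \<in> ideal_mult (Obst n) (ideal_mult (CAP n) (CAP n))"
    \<comment> \<open>The empty sum, \<open>m = 0\<close>, represents 0.\<close>
    unfolding ideal_mult_def by (auto intro!: exI[of _ "0::nat"])
qed

end
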